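(* Let $\Gamma$ be the space of pairs $(\mathbb F,B)\in GL_N\times GL_N$ endowed with the Poisson bracket $\Omega$ defined by $$\{\overset{1}{B},\overset{2}{B}\}=r_{12}\overset{1}{B}\overset{2}{B}-\overset{1}{B}\overset{2}{B}r_{12},\qquad \{\overset{1}{B},\overset{2}{\mathbb F}\}=\overset{1}{B}r_{12}\overset{2}{\mathbb F}-\overset{1}{B}\overset{2}{\mathbb F}r_{12}^{t_1},$$ $$\{\overset{1}{\mathbb F},\overset{2}{\mathbb F}\}=-r_{12}\overset{1}{\mathbb F}\overset{2}{\mathbb F}+\overset{1}{\mathbb F}\overset{2}{\mathbb F}r_{12}-\overset{1}{\mathbb F}r_{12}^{t_1}\overset{2}{\mathbb F}+\overset{2}{\mathbb F}r_{12}^{t_1}\overset{1}{\mathbb F}.$$ Then $\Gamma$ satisfies the definition of a Poisson (symplectic) groupoid given in the context: for three mutually Poisson commuting pairs $(\mathbb F_i,B_i)\in GL_N\times GL_N$, $i=1,2,3$, endowed with the Poisson structures $\Omega,\Omega,-\Omega$ respectively, all the entries of the constraints $$f:=B_3-B_2B_1,\qquad g:=\mathbb F_3-\mathbb F_1,\qquad h:=\mathbb F_2-B_1\mathbb F_1B_1^{\mathrm T}$$ mutually Poisson commute on the constraint surface $f=g=h=0$.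
   Context: $E_{i,j}$ are the $N\times N$ matrix units. For an $N\times N$ matrix $X$ write $\overset{1}{X}=X\otimes I$, $\overset{2}{X}=I\otimes X$. $T^{t_1}$ denotes transposition in the first tensor factor. $\{\overset{1}{X},\overset{2}{Y}\}=\sum_{i,j,k,l}\{x_{i,j},y_{k,l}\}E_{i,j}\otimes E_{k,l}$. The classical $r$-matrix is $r_{12}=\sum_iE_{i,i}\otimes E_{i,i}+2\sum_{i>j}E_{i,j}\otimes E_{j,i}$. The groupoid has source $s(\mathbb F,B)=\mathbb F$, target $t(\mathbb F,B)=B\mathbb FB^{\mathrm T}$, and the product of $(\mathbb F_1,B_1)$ and $(\mathbb F_2,B_2)$ is defined when $\mathbb F_2=B_1\mathbb F_1B_1^{\mathrm T}$ and equals $(\mathbb F_1,B_2B_1)$. Definition used in the paper: a Poisson (symplectic) groupoid is a groupoid $\Gamma$ with a Poisson structure $\Omega$ such that the graph $\{(x,y,m(x,y)):(x,y)\in\Gamma_2\}$ of the multiplication $m$ (with $\Gamma_2$ the set of composable pairs) is a Lagrangian submanifold of $(\Gamma,\Omega)\times(\Gamma,\Omega)\times(\Gamma,-\Omega)$; here Lagrangian is understood as: all the constraints defining the graph Poisson commute on the constraint surface. *)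

theory Defs
  imports "HOL-Analysis.Analysis"
begin

text \<open>
  The ground field is a \<^class>\<open>real_normed_field\<close> \<open>'a\<close> (up to isomorphism, the reals or the
  complex numbers), and the matrix size \<open>N\<close> is the cardinality of a finite linearly
  ordered index type \<open>'n\<close>; the order is needed because the \<open>r\<close>-matrix refers to \<open>i > j\<close>.
\<close>

type_synonym ('a, 'n) mat = "'a ^ 'n ^ 'n"

text \<open>Endomorphisms of the tensor square, as matrices whose rows and columns are pairs.\<close>

type_synonym ('a, 'n) mat2 = "'a ^ ('n \<times> 'n) ^ ('n \<times> 'n)"

type_synonym ('a, 'n) pt = "('a, 'n) mat \<times> ('a, 'n) mat"

type_synonym ('a, 'n) pt3 = "('a, 'n) pt \<times> ('a, 'n) pt \<times> ('a, 'n) pt"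


section \<open>Tensor notation and the classical r-matrix\<close>

text \<open>\<open>elem_mat i j t\<close> is \<open>t\<close> times the matrix unit \<open>E\<^sub>i\<^sub>j\<close>.\<close>

definition elem_mat :: "'n \<Rightarrow> 'n \<Rightarrow> 'a::zero \<Rightarrow> ('a, 'n::finite) mat" where
  "elem_mat i j t = (\<chi> k l. if k = i \<and> l = j then t else 0)"

definition tensor :: "('a::times, 'n::finite) mat \<Rightarrow> ('a, 'n) mat \<Rightarrow> ('a, 'n) mat2"
    (infixl \<open>\<otimes>\<^sub>m\<close> 72) where
  "X \<otimes>\<^sub>m Y = (\<chi> ik jl. X $ fst ik $ fst jl * Y $ snd ik $ snd jl)"

definition leg1 :: "('a::semiring_1, 'n::finite) mat \<Rightarrow> ('a, 'n) mat2" where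
  "leg1 X = X \<otimes>\<^sub>m mat 1"

definition leg2 :: "('a::semiring_1, 'n::finite) mat \<Rightarrow> ('a, 'n) mat2" where
  "leg2 X = mat 1 \<otimes>\<^sub>m X"

definition transpose1 :: "('a, 'n::finite) mat2 \<Rightarrow> ('a, 'n) mat2" where
  "transpose1 T = (\<chi> ik jl. T $ (fst jl, snd ik) $ (fst ik, snd jl))"

definition r12 :: "('a::real_normed_field, 'n::{finite,linorder}) mat2" where
  "r12 = (\<Sum>i\<in>UNIV. elem_mat i i 1 \<otimes>\<^sub>m elem_mat i i 1)
       + 2 *\<^sub>R (\<Sum>(i, j)\<in>{(i, j). i > j}. elem_mat i j 1 \<otimes>\<^sub>m elem_mat j i 1)"


section \<open>The space of pairs and its smooth functions\<close>

text \<open>Points are pairs \<open>(F, B)\<close>.\<close>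

definition GL :: "('a::semiring_1, 'n::finite) mat set" where
  "GL = {A. invertible A}"

definition Gam :: "('a::semiring_1, 'n::finite) pt set" where
  "Gam = GL \<times> GL"

text \<open>Partial derivatives with respect to the matrix entries of \<open>F\<close> and of \<open>B\<close>.\<close>

definition dF :: "'n \<Rightarrow> 'n \<Rightarrow> (('a::real_normed_field, 'n::finite) pt \<Rightarrow> 'a) \<Rightarrow> ('a, 'n) pt \<Rightarrow> 'a" where
  "dF i j \<phi> p = deriv (\<lambda>t. \<phi> (fst p + elem_mat i j t, snd p)) 0"

definition dB :: "'n \<Rightarrow> 'n \<Rightarrow> (('a::real_normed_field, 'n::finite) pt \<Rightarrow> 'a) \<Rightarrow> ('a, 'n) pt \<Rightarrow> 'a" where
  "dB i j \<phi> p = deriv (\<lambda>t. \<phi> (fst p, snd p + elem_mat i j t)) 0"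

text \<open>
  \<open>C_on k U \<phi>\<close>: on the open set \<open>U\<close>, all iterated partial derivatives of \<open>\<phi>\<close> up to order
  \<open>k\<close> exist and are continuous. Over the complex numbers \<open>smooth_on\<close> means holomorphic.
\<close>

primrec C_on :: "nat \<Rightarrow> ('a::real_normed_field, 'n::finite) pt set \<Rightarrow> (('a, 'n) pt \<Rightarrow> 'a) \<Rightarrow> bool" where
  "C_on 0 U \<phi> \<longleftrightarrow> continuous_on U \<phi>"
| "C_on (Suc k) U \<phi> \<longleftrightarrow> continuous_on U \<phi> \<and>
     (\<forall>i j. (\<forall>(F, B)\<in>U.
                (\<lambda>t. \<phi> (F + elem_mat i j t, B)) field_differentiable (at 0) \<and>
                (\<lambda>t. \<phi> (F, B + elem_mat i j t)) field_differentiable (at 0)) \<and>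
            C_on k U (dF i j \<phi>) \<and> C_on k U (dB i j \<phi>))"

definition smooth_on :: "('a::real_normed_field, 'n::finite) pt set \<Rightarrow> (('a, 'n) pt \<Rightarrow> 'a) \<Rightarrow> bool" where
  "smooth_on U \<phi> \<longleftrightarrow> (\<forall>k. C_on k U \<phi>)"

text \<open>
  A Poisson bracket on the smooth functions on \<open>U\<close>. Functions are total, so the first
  conjunct says that the bracket on \<open>U\<close> only depends on the values on \<open>U\<close>.
\<close>

definition poisson_bracket_on ::
    "('a::real_normed_field, 'n::finite) pt set
      \<Rightarrow> ((('a, 'n) pt \<Rightarrow> 'a) \<Rightarrow> (('a, 'n) pt \<Rightarrow> 'a) \<Rightarrow> ('a, 'n) pt \<Rightarrow> 'a) \<Rightarrow> bool" where
  "poisson_bracket_on U br \<longleftrightarrow>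
     (\<forall>\<phi> \<phi>' \<psi>. smooth_on U \<phi> \<and> smooth_on U \<phi>' \<and> smooth_on U \<psi> \<and> (\<forall>p\<in>U. \<phi> p = \<phi>' p) \<longrightarrow>
        (\<forall>p\<in>U. br \<phi> \<psi> p = br \<phi>' \<psi> p)) \<and>
     (\<forall>\<phi> \<psi>. smooth_on U \<phi> \<and> smooth_on U \<psi> \<longrightarrow>
        smooth_on U (br \<phi> \<psi>) \<and> (\<forall>p\<in>U. br \<phi> \<psi> p = - br \<psi> \<phi> p)) \<and>
     (\<forall>\<phi> \<psi> \<theta>. smooth_on U \<phi> \<and> smooth_on U \<psi> \<and> smooth_on U \<theta> \<longrightarrow>
        (\<forall>p\<in>U.
          (\<forall>c. br (\<lambda>x. c * \<phi> x + \<psi> x) \<theta> p = c * br \<phi> \<theta> p + br \<psi> \<theta> p) \<and>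
          br (\<lambda>x. \<phi> x * \<psi> x) \<theta> p = \<phi> p * br \<psi> \<theta> p + br \<phi> \<theta> p * \<psi> p \<and>
          br \<phi> (br \<psi> \<theta>) p + br \<psi> (br \<theta> \<phi>) p + br \<theta> (br \<phi> \<psi>) p = 0))"


section \<open>The bracket\<close>

text \<open>
  The matrices of brackets between the entries of \<open>B\<close> and \<open>F\<close>. By the convention for
  the bracket of two legs, the entry in row \<open>(i, k)\<close> and column \<open>(j, l)\<close> of the matrix
  for \<open>X\<close>, \<open>Y\<close> is the bracket of \<open>X\<^sub>i\<^sub>j\<close> with \<open>Y\<^sub>k\<^sub>l\<close>.
\<close>

fun brBB :: "('a::real_normed_field, 'n::{finite,linorder}) pt \<Rightarrow> ('a, 'n) mat2" where
  "brBB (F, B) = r12 ** leg1 B ** leg2 B - leg1 B ** leg2 B ** r12"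

fun brBF :: "('a::real_normed_field, 'n::{finite,linorder}) pt \<Rightarrow> ('a, 'n) mat2" where
  "brBF (F, B) = leg1 B ** r12 ** leg2 F - leg1 B ** leg2 F ** transpose1 r12"

fun brFF :: "('a::real_normed_field, 'n::{finite,linorder}) pt \<Rightarrow> ('a, 'n) mat2" where
  "brFF (F, B) = - (r12 ** leg1 F ** leg2 F) + leg1 F ** leg2 F ** r12
     - leg1 F ** transpose1 r12 ** leg2 F + leg2 F ** transpose1 r12 ** leg1 F"

text \<open>
  The biderivation with these values on the coordinate functions; the bracket of an entry
  of \<open>F\<close> with an entry of \<open>B\<close> is fixed by skew-symmetry.
\<close>

definition Omega ::
    "(('a::real_normed_field, 'n::{finite,linorder}) pt \<Rightarrow> 'a) \<Rightarrow> (('a, 'n) pt \<Rightarrow> 'a) \<Rightarrow> ('a, 'n) pt \<Rightarrow> 'a" where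
  "Omega \<phi> \<psi> p = (\<Sum>i\<in>UNIV. \<Sum>j\<in>UNIV. \<Sum>k\<in>UNIV. \<Sum>l\<in>UNIV.
       brBB p $ (i, k) $ (j, l) * (dB i j \<phi> p * dB k l \<psi> p)
     + brBF p $ (i, k) $ (j, l) * (dB i j \<phi> p * dF k l \<psi> p - dF k l \<phi> p * dB i j \<psi> p)
     + brFF p $ (i, k) $ (j, l) * (dF i j \<phi> p * dF k l \<psi> p))"

lemma has_deriv_entry:
  fixes A :: "('a::real_normed_field, 'n::finite) mat"
  shows "((\<lambda>t. (A + elem_mat i j t) $ k $ l) has_field_derivative (if k = i \<and> l = j then 1 else 0)) (at 0)"
  unfolding elem_mat_def
  by (cases "k = i \<and> l = j") (auto intro!: derivative_eq_intros)

lemma dF_dB_entries: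
  fixes p :: "('a::real_normed_field, 'n::finite) pt"
  shows "dF i j (\<lambda>q. fst q $ k $ l) p = (if k = i \<and> l = j then 1 else 0)"
    and "dB i j (\<lambda>q. snd q $ k $ l) p = (if k = i \<and> l = j then 1 else 0)"
    and "dF i j (\<lambda>q. snd q $ k $ l) p = 0"
    and "dB i j (\<lambda>q. fst q $ k $ l) p = 0"
  unfolding dF_def dB_def fst_conv snd_conv
  by (rule DERIV_imp_deriv[OF has_deriv_entry] | simp)+

lemma Omega_entries:
  fixes p :: "('a::real_normed_field, 'n::{finite,linorder}) pt"
  shows "Omega (\<lambda>q. snd q $ i $ j) (\<lambda>q. snd q $ k $ l) p = brBB p $ (i, k) $ (j, l)"
    and "Omega (\<lambda>q. snd q $ i $ j) (\<lambda>q. fst q $ k $ l) p = brBF p $ (i, k) $ (j, l)"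
    and "Omega (\<lambda>q. fst q $ i $ j) (\<lambda>q. fst q $ k $ l) p = brFF p $ (i, k) $ (j, l)"
proof -
  have *: "(\<Sum>a\<in>UNIV. \<Sum>b\<in>UNIV. \<Sum>c\<in>UNIV. \<Sum>d\<in>UNIV.
      G a b c d * ((if i = a \<and> j = b then 1 else 0) * (if k = c \<and> l = d then 1 else 0))) = G i j k l"
    for G :: "'n \<Rightarrow> 'n \<Rightarrow> 'n \<Rightarrow> 'n \<Rightarrow> 'a"
  proof -
    have "G a b c d * ((if i = a \<and> j = b then 1 else 0) * (if k = c \<and> l = d then 1 else 0))
      = (if d = l then if c = k then if b = j then if a = i then G a b c d else 0 else 0 else 0 else 0)"
      for a b c d by auto
    then show ?thesis by simp
  qed
  show "Omega (\<lambda>q. snd q $ i $ j) (\<lambda>q. snd q $ k $ l) p = brBB p $ (i, k) $ (j, l)"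
    "Omega (\<lambda>q. snd q $ i $ j) (\<lambda>q. fst q $ k $ l) p = brBF p $ (i, k) $ (j, l)"
    "Omega (\<lambda>q. fst q $ i $ j) (\<lambda>q. fst q $ k $ l) p = brFF p $ (i, k) $ (j, l)"
    unfolding Omega_def dF_dB_entries
    by (simp_all only: mult_zero_left mult_zero_right add_0_left add_0_right diff_zero *)
qed

text \<open>The bracket on triples of points which is \<open>Omega\<close>, \<open>Omega\<close>, \<open>- Omega\<close> on the factors.\<close>

fun Omega3 ::
    "(('a::real_normed_field, 'n::{finite,linorder}) pt3 \<Rightarrow> 'a) \<Rightarrow> (('a, 'n) pt3 \<Rightarrow> 'a) \<Rightarrow> ('a, 'n) pt3 \<Rightarrow> 'a" where
  "Omega3 \<phi> \<psi> (x, y, z) =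
     Omega (\<lambda>u. \<phi> (u, y, z)) (\<lambda>u. \<psi> (u, y, z)) x
   + Omega (\<lambda>u. \<phi> (x, u, z)) (\<lambda>u. \<psi> (x, u, z)) y
   - Omega (\<lambda>u. \<phi> (x, y, u)) (\<lambda>u. \<psi> (x, y, u)) z"


section \<open>The groupoid\<close>

text \<open>\<open>m x y\<close> is the product of \<open>x\<close> and \<open>y\<close>, composable when the target of \<open>x\<close> is the source of \<open>y\<close>.\<close>

definition groupoid :: "'o set \<Rightarrow> 'm set \<Rightarrow> ('m \<Rightarrow> 'o) \<Rightarrow> ('m \<Rightarrow> 'o) \<Rightarrow> ('m \<Rightarrow> 'm \<Rightarrow> 'm) \<Rightarrow> bool" where
  "groupoid Obj Arr s t m \<longleftrightarrow>
     s ` Arr \<subseteq> Obj \<and> t ` Arr \<subseteq> Obj \<and>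
     (\<forall>x\<in>Arr. \<forall>y\<in>Arr. t x = s y \<longrightarrow> m x y \<in> Arr \<and> s (m x y) = s x \<and> t (m x y) = t y) \<and>
     (\<forall>x\<in>Arr. \<forall>y\<in>Arr. \<forall>z\<in>Arr. t x = s y \<and> t y = s z \<longrightarrow> m (m x y) z = m x (m y z)) \<and>
     (\<exists>e. (\<forall>a\<in>Obj. e a \<in> Arr \<and> s (e a) = a \<and> t (e a) = a) \<and>
          (\<forall>x\<in>Arr. m (e (s x)) x = x \<and> m x (e (t x)) = x) \<and>
          (\<forall>x\<in>Arr. \<exists>y\<in>Arr. s y = t x \<and> t y = s x \<and> m x y = e (s x) \<and> m y x = e (t x)))"

fun src :: "('a::semiring_1, 'n::finite) pt \<Rightarrow> ('a, 'n) mat" where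
  "src (F, B) = F"

fun tgt :: "('a::semiring_1, 'n::finite) pt \<Rightarrow> ('a, 'n) mat" where
  "tgt (F, B) = B ** F ** transpose B"

fun gmult :: "('a::semiring_1, 'n::finite) pt \<Rightarrow> ('a, 'n) pt \<Rightarrow> ('a, 'n) pt" where
  "gmult (F1, B1) (F2, B2) = (F1, B2 ** B1)"

definition graph_of_mult :: "('a::semiring_1, 'n::finite) pt3 set" where
  "graph_of_mult = {(x, y, gmult x y) | x y. x \<in> Gam \<and> y \<in> Gam \<and> tgt x = src y}"

fun constr_f :: "('a::ring_1, 'n::finite) pt3 \<Rightarrow> ('a, 'n) mat" where
  "constr_f ((F1, B1), (F2, B2), (F3, B3)) = B3 - B2 ** B1"

fun constr_g :: "('a::ring_1, 'n::finite) pt3 \<Rightarrow> ('a, 'n) mat" where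
  "constr_g ((F1, B1), (F2, B2), (F3, B3)) = F3 - F1"

fun constr_h :: "('a::ring_1, 'n::finite) pt3 \<Rightarrow> ('a, 'n) mat" where
  "constr_h ((F1, B1), (F2, B2), (F3, B3)) = F2 - B1 ** F1 ** transpose B1"

definition constraints :: "(('a::ring_1, 'n::finite) pt3 \<Rightarrow> 'a) set" where
  "constraints = {(\<lambda>p. c p $ i $ j) | c i j. c \<in> {constr_f, constr_g, constr_h}}"

definition constraint_surface :: "('a::ring_1, 'n::finite) pt3 set" where
  "constraint_surface =
     {p \<in> Gam \<times> Gam \<times> Gam. constr_f p = 0 \<and> constr_g p = 0 \<and> constr_h p = 0}"

end

theory Submission
  imports Defs
begin

text \<open>
  Write \<open>s\<close> for the sign of the order on the indices. The bracket of entries of \<open>B\<close> is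
  \<open>{B\<^sub>i\<^sub>j, B\<^sub>k\<^sub>l} = (s\<^sub>i\<^sub>k + s\<^sub>j\<^sub>l) B\<^sub>k\<^sub>j B\<^sub>i\<^sub>l\<close>, and an entry \<open>F\<^sub>k\<^sub>l\<close> acts by an
  infinitesimal change of basis: with a matrix \<open>M = M\<^sub>k\<^sub>l(F)\<close> linear in \<open>F\<close>,
  \<open>{B, F\<^sub>k\<^sub>l} = B M\<close> and \<open>{F, F\<^sub>k\<^sub>l} = - (M F + F M\<^sup>T)\<close>.

  The Jacobi identity reduces to coordinates, since the second derivatives cancel. There it
  follows from \<open>s\<^sub>a\<^sub>b s\<^sub>b\<^sub>c + s\<^sub>b\<^sub>c s\<^sub>c\<^sub>a + s\<^sub>c\<^sub>a s\<^sub>a\<^sub>b = - 1\<close> (valid unless \<open>a = b = c\<close>); as soon as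
  two entries of \<open>F\<close> are involved, it says that \<open>M\<close> is flat.

  For the constraints, the target \<open>G = B F B\<^sup>T\<close> commutes with \<open>F\<close> by the form of the
  action, and \<open>{B, G\<^sub>k\<^sub>l} = M\<^sub>k\<^sub>l(G) B\<close>, so that \<open>{G, G\<^sub>k\<^sub>l} = M G + G M\<^sup>T\<close> is opposite to the
  bracket of \<open>F\<close>. On the surface the three contributions then cancel.
\<close>

section \<open>Partial derivatives\<close>

text \<open>A coordinate is a triple: a flag, true for \<open>F\<close> and false for \<open>B\<close>, and the two matrix indices.\<close>

type_synonym 'n coord = "bool \<times> 'n \<times> 'n"

fun coord :: "'n coord \<Rightarrow> ('a, 'n::finite) pt \<Rightarrow> 'a" where
  "coord (b, i, j) p = (if b then fst p else snd p) $ i $ j"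

fun step :: "'n coord \<Rightarrow> 'a \<Rightarrow> ('a::real_normed_field, 'n::finite) pt" where
  "step (b, i, j) t = (if b then (elem_mat i j t, 0) else (0, elem_mat i j t))"

text \<open>A single operator replaces \<open>dF\<close> and \<open>dB\<close>, so that Leibniz
  rules and index sums run over one finite coordinate type instead of two families.\<close>

definition pd :: "'n coord \<Rightarrow> (('a::real_normed_field, 'n::finite) pt \<Rightarrow> 'a) \<Rightarrow> ('a, 'n) pt \<Rightarrow> 'a" where
  "pd c \<phi> p = deriv (\<lambda>t. \<phi> (p + step c t)) 0"

text \<open>Differentiability along the coordinate axes through \<open>p\<close> only. This is
  exactly what the sum and product rules for \<open>pd\<close> ask for.\<close>

definition pdiff :: "(('a::real_normed_field, 'n::finite) pt \<Rightarrow> 'a) \<Rightarrow> ('a, 'n) pt \<Rightarrow> bool" where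
  "pdiff \<phi> p \<longleftrightarrow> (\<forall>c. (\<lambda>t. \<phi> (p + step c t)) field_differentiable (at 0))"

lemma pd_dF: "pd (True, i, j) = dF i j"
  and pd_dB: "pd (False, i, j) = dB i j"
  by (simp_all add: fun_eq_iff pd_def dF_def dB_def plus_prod_def)

lemma elem_mat_zero [simp]: "elem_mat i j 0 = 0"
  by (simp add: elem_mat_def vec_eq_iff)

lemma elem_mat_add: "elem_mat i j (s + t) = elem_mat i j s + elem_mat i j (t::'a::monoid_add)"
  by (auto simp: elem_mat_def vec_eq_iff)

lemma step_zero [simp]: "step c 0 = 0"
  by (cases c) (simp add: zero_prod_def)

lemma step_add: "step c (s + t) = step c s + step c t"
  by (cases c) (simp add: elem_mat_add)

lemma continuous_on_step: "continuous_on UNIV (step c)"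
proof -
  have "continuous_on UNIV (elem_mat i j :: 'a \<Rightarrow> ('a::real_normed_field, 'n::finite) mat)" for i j
    unfolding elem_mat_def
  proof (intro continuous_on_vec_lambda)
    show "continuous_on UNIV (\<lambda>t::'a. if k = i \<and> l = j then t else 0)" for k l
      by (cases "k = i \<and> l = j") auto
  qed
  then show ?thesis
    by (cases c; cases "fst c") (auto intro!: continuous_on_Pair)
qed

lemma tendsto_step: "((\<lambda>x. step c (f x)) \<longlongrightarrow> step c l) G" if "(f \<longlongrightarrow> l) G"
  using continuous_on_tendsto_compose[OF continuous_on_step that] by simp

lemma has_pd:
  assumes "pdiff \<phi> p"
  shows "((\<lambda>t. \<phi> (p + step c t)) has_field_derivative pd c \<phi> p) (at 0)"
  using assms unfolding pdiff_def pd_def by (metis DERIV_deriv_iff_field_differentiable)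

lemma pdI:
  assumes "\<And>c. ((\<lambda>t. \<phi> (p + step c t)) has_field_derivative D c) (at 0)"
  shows "pdiff \<phi> p" "pd c \<phi> p = D c"
  unfolding pdiff_def field_differentiable_def pd_def
  using assms by (blast, intro DERIV_imp_deriv assms)

lemma pd_const: "pd c (\<lambda>_. k) = (\<lambda>_. 0)" and pdiff_const: "pdiff (\<lambda>_. k) p"
  by (auto simp: pd_def pdiff_def)

lemma coord_has_pd:
  "((\<lambda>t. coord d (p + step c t)) has_field_derivative (if d = c then 1 else 0)) (at 0)"
proof -
  obtain b i j b' i' j' where cd: "c = (b, i, j)" "d = (b', i', j')"
    by (cases c; cases d)
  show ?thesis
    unfolding cd using has_deriv_entry[of "if b then fst p else snd p" i j i' j']
    by (cases b; cases b') auto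
qed

lemma pd_coord: "pd c (coord d) p = (if d = c then 1 else 0)"
  and pdiff_coord: "pdiff (coord d) p"
  by (rule pdI[OF coord_has_pd])+

lemma
  assumes "pdiff \<phi> p" "pdiff \<psi> p"
  shows pd_add: "pd c (\<lambda>q. \<phi> q + \<psi> q) p = pd c \<phi> p + pd c \<psi> p"
    and pdiff_add: "pdiff (\<lambda>q. \<phi> q + \<psi> q) p"
    and pd_diff: "pd c (\<lambda>q. \<phi> q - \<psi> q) p = pd c \<phi> p - pd c \<psi> p"
    and pdiff_diff: "pdiff (\<lambda>q. \<phi> q - \<psi> q) p"
    and pd_mult: "pd c (\<lambda>q. \<phi> q * \<psi> q) p = pd c \<phi> p * \<psi> p + \<phi> p * pd c \<psi> p"
    and pdiff_mult: "pdiff (\<lambda>q. \<phi> q * \<psi> q) p"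
proof -
  note d = has_pd[OF assms(1)] has_pd[OF assms(2)]
  show "pd c (\<lambda>q. \<phi> q + \<psi> q) p = pd c \<phi> p + pd c \<psi> p" "pdiff (\<lambda>q. \<phi> q + \<psi> q) p"
    by (rule pdI[OF DERIV_add[OF d]])+
  show "pd c (\<lambda>q. \<phi> q - \<psi> q) p = pd c \<phi> p - pd c \<psi> p" "pdiff (\<lambda>q. \<phi> q - \<psi> q) p"
    by (rule pdI[OF DERIV_diff[OF d]])+
  have m: "((\<lambda>t. \<phi> (p + step c t) * \<psi> (p + step c t)) has_field_derivative
      (pd c \<phi> p * \<psi> p + \<phi> p * pd c \<psi> p)) (at 0)" for c
    using DERIV_mult[OF d(1)[of c] d(2)[of c]] by (simp add: algebra_simps)
  show "pd c (\<lambda>q. \<phi> q * \<psi> q) p = pd c \<phi> p * \<psi> p + \<phi> p * pd c \<psi> p" "pdiff (\<lambda>q. \<phi> q * \<psi> q) p"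
    by (rule pdI[OF m])+
qed

lemma
  assumes "pdiff \<phi> p"
  shows pd_minus: "pd c (\<lambda>q. - \<phi> q) p = - pd c \<phi> p"
    and pdiff_minus: "pdiff (\<lambda>q. - \<phi> q) p"
  using pd_diff[OF pdiff_const assms, of c 0] pdiff_diff[OF pdiff_const assms, of 0]
  by (simp_all add: pd_const)

lemma
  assumes "\<And>i. i \<in> I \<Longrightarrow> pdiff (\<phi> i) p"
  shows pd_sum: "pd c (\<lambda>q. \<Sum>i\<in>I. \<phi> i q) p = (\<Sum>i\<in>I. pd c (\<phi> i) p)"
    and pdiff_sum: "pdiff (\<lambda>q. \<Sum>i\<in>I. \<phi> i q) p"
proof -
  have "((\<lambda>t. \<Sum>i\<in>I. \<phi> i (p + step c t)) has_field_derivative (\<Sum>i\<in>I. pd c (\<phi> i) p)) (at 0)" for c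
    using assms by (intro DERIV_sum has_pd)
  from pdI[OF this] show "pd c (\<lambda>q. \<Sum>i\<in>I. \<phi> i q) p = (\<Sum>i\<in>I. pd c (\<phi> i) p)"
    "pdiff (\<lambda>q. \<Sum>i\<in>I. \<phi> i q) p" by simp_all
qed

text \<open>The line \<open>p + step c t\<close> stays in the open set \<open>U\<close> for
  \<open>t\<close> near \<open>0\<close>, so both notions depend only on the values near
  \<open>p\<close>.\<close>

lemma pd_cong:
  assumes "open U" "p \<in> U" "\<And>q. q \<in> U \<Longrightarrow> \<phi> q = \<psi> q"
  shows "pd c \<phi> p = pd c \<psi> p" and "pdiff \<phi> p \<longleftrightarrow> pdiff \<psi> p"
proof -
  have ev: "\<forall>\<^sub>F t in nhds 0. \<phi> (p + step c t) = \<psi> (p + step c t)" for c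
  proof -
    have "((\<lambda>t. p + step c t) \<longlongrightarrow> p + step c 0) (nhds 0)"
      by (intro tendsto_add tendsto_const tendsto_step filterlim_ident)
    then have "\<forall>\<^sub>F t in nhds 0. p + step c t \<in> U"
      using assms(1,2) by (simp add: tendsto_def)
    then show ?thesis
      by eventually_elim (rule assms(3))
  qed
  show "pd c \<phi> p = pd c \<psi> p"
    unfolding pd_def by (rule deriv_cong_ev[OF ev refl])
  show "pdiff \<phi> p \<longleftrightarrow> pdiff \<psi> p"
    unfolding pdiff_def field_differentiable_def
    using DERIV_cong_ev[OF refl ev refl] by metis
qed


section \<open>Smooth functions\<close>

lemma all_coord: "(\<forall>c. P c) \<longleftrightarrow> (\<forall>i j. P (True, i, j) \<and> P (False, i, j))"
  by (metis (full_types) prod_cases3)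

text \<open>The conditions on both families of partial derivatives merge into one quantifier over
  \<open>c\<close>. The inductions on the order use this form.\<close>

lemma C_on_Suc_iff:
  "C_on (Suc k) U \<phi> \<longleftrightarrow> continuous_on U \<phi> \<and> (\<forall>p\<in>U. pdiff \<phi> p) \<and> (\<forall>c. C_on k U (pd c \<phi>))"
proof -
  have "(\<forall>p\<in>U. pdiff \<phi> p) \<longleftrightarrow> (\<forall>i j. \<forall>(F, B)\<in>U.
      (\<lambda>t. \<phi> (F + elem_mat i j t, B)) field_differentiable (at 0) \<and>
      (\<lambda>t. \<phi> (F, B + elem_mat i j t)) field_differentiable (at 0))"
    unfolding pdiff_def all_coord by (simp add: split_beta plus_prod_def) blast
  then show ?thesis
    unfolding C_on.simps all_coord pd_dF pd_dB by blast
qed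

declare C_on.simps(2) [simp del]

lemma C_on_SucI:
  assumes "continuous_on U \<phi>" "\<And>p. p \<in> U \<Longrightarrow> pdiff \<phi> p" "\<And>c. C_on k U (pd c \<phi>)"
  shows "C_on (Suc k) U \<phi>"
  unfolding C_on_Suc_iff using assms by blast

lemma C_on_SucD:
  assumes "C_on (Suc k) U \<phi>"
  shows "continuous_on U \<phi>" "p \<in> U \<Longrightarrow> pdiff \<phi> p" "C_on k U (pd c \<phi>)"
  using assms unfolding C_on_Suc_iff by blast+

text \<open>Rules such as \<open>pd_mult\<close> identify a derivative only at the points of
  \<open>U\<close>; this lemma lets the inductions replace it by the computed expression.\<close>

lemma C_on_cong:
  assumes "open U"
  shows "(\<And>p. p \<in> U \<Longrightarrow> \<phi> p = \<psi> p) \<Longrightarrow> C_on k U \<phi> \<Longrightarrow> C_on k U \<psi>"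
proof (induction k arbitrary: \<phi> \<psi>)
  case 0
  then show ?case by (simp cong: continuous_on_cong)
next
  case (Suc k)
  note \<phi> = C_on_SucD[OF Suc.prems(2)]
  show ?case
  proof (rule C_on_SucI)
    show "continuous_on U \<psi>"
      using \<phi>(1) Suc.prems(1) by (simp cong: continuous_on_cong)
    show "pdiff \<psi> p" if "p \<in> U" for p
      using pd_cong(2)[OF assms that, of \<phi> \<psi>] Suc.prems(1) \<phi>(2)[OF that] by blast
    show "C_on k U (pd c \<psi>)" for c
      by (rule Suc.IH[OF pd_cong(1)[OF assms _ Suc.prems(1)] \<phi>(3)])
  qed
qed

lemma C_on_Suc_imp: "C_on (Suc k) U \<phi> \<Longrightarrow> C_on k U \<phi>"
proof (induction k arbitrary: \<phi>)
  case (Suc k)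
  note \<phi> = C_on_SucD[OF Suc.prems]
  show ?case
    by (rule C_on_SucI[OF \<phi>(1,2) Suc.IH[OF \<phi>(3)]])
qed (simp add: C_on_SucD)

lemma C_on_const: "C_on k U (\<lambda>_. c)"
  by (induction k arbitrary: c) (simp_all add: C_on_SucI pd_const pdiff_const)

lemma continuous_on_coord: "continuous_on U (coord c)"
proof -
  obtain b i j where c: "c = (b, i, j)" by (cases c)
  have "continuous_on U (\<lambda>p. fst p $ i $ j)" "continuous_on U (\<lambda>p. snd p $ i $ j)"
    by (intro continuous_intros)+
  then have "continuous_on U (\<lambda>p. coord c p)"
    unfolding c coord.simps by (cases b) simp_all
  then show ?thesis by simp
qed

lemma C_on_coord: "C_on k U (coord c)"
proof (cases k)
  case (Suc k')
  have *: "pd d (coord c) = (\<lambda>_. if c = d then 1 else 0)" for d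
    by (rule ext) (rule pd_coord)
  show ?thesis
    unfolding Suc by (rule C_on_SucI) (simp_all only: continuous_on_coord pdiff_coord * C_on_const)
qed (simp add: continuous_on_coord)

lemma C_on_add:
  assumes "open U"
  shows "C_on k U \<phi> \<Longrightarrow> C_on k U \<psi> \<Longrightarrow> C_on k U (\<lambda>p. \<phi> p + \<psi> p)"
proof (induction k arbitrary: \<phi> \<psi>)
  case (Suc k)
  note d = C_on_SucD[OF Suc.prems(1)] C_on_SucD[OF Suc.prems(2)]
  show ?case
  proof (rule C_on_SucI)
    show "continuous_on U (\<lambda>p. \<phi> p + \<psi> p)" by (intro continuous_on_add d)
    show "pdiff (\<lambda>p. \<phi> p + \<psi> p) p" if "p \<in> U" for p by (intro pdiff_add d that)
    show "C_on k U (pd c (\<lambda>p. \<phi> p + \<psi> p))" for c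
      by (rule C_on_cong[OF assms _ Suc.IH[OF d(3)[of c] d(6)[of c]]]) (simp add: pd_add d)
  qed
qed (auto intro: continuous_on_add)

text \<open>Each term of the product rule pairs a derivative of order \<open>k\<close> with an
  undifferentiated factor of order \<open>Suc k\<close>; lowering the latter by
  \<open>C_on_Suc_imp\<close> makes the induction hypothesis applicable.\<close>

lemma C_on_mult:
  assumes "open U"
  shows "C_on k U \<phi> \<Longrightarrow> C_on k U \<psi> \<Longrightarrow> C_on k U (\<lambda>p. \<phi> p * \<psi> p)"
proof (induction k arbitrary: \<phi> \<psi>)
  case (Suc k)
  note d = C_on_SucD[OF Suc.prems(1)] C_on_SucD[OF Suc.prems(2)]
  show ?case
  proof (rule C_on_SucI)
    show "continuous_on U (\<lambda>p. \<phi> p * \<psi> p)" by (intro continuous_on_mult d)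
    show "pdiff (\<lambda>p. \<phi> p * \<psi> p) p" if "p \<in> U" for p by (intro pdiff_mult d that)
    show "C_on k U (pd c (\<lambda>p. \<phi> p * \<psi> p))" for c
    proof (rule C_on_cong[OF assms])
      show "C_on k U (\<lambda>p. pd c \<phi> p * \<psi> p + \<phi> p * pd c \<psi> p)"
        by (rule C_on_add[OF assms Suc.IH[OF d(3) C_on_Suc_imp[OF Suc.prems(2)]]
              Suc.IH[OF C_on_Suc_imp[OF Suc.prems(1)] d(6)]])
    qed (simp add: pd_mult d)
  qed
qed (auto intro: continuous_on_mult)

lemma smooth_on_const: "smooth_on U (\<lambda>_. k)"
  and smooth_on_coord: "smooth_on U (coord c)"
  by (simp_all add: smooth_on_def C_on_const C_on_coord)

lemma
  assumes "open U" "smooth_on U \<phi>" "smooth_on U \<psi>"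
  shows smooth_on_add: "smooth_on U (\<lambda>p. \<phi> p + \<psi> p)"
    and smooth_on_mult: "smooth_on U (\<lambda>p. \<phi> p * \<psi> p)"
    and smooth_on_diff: "smooth_on U (\<lambda>p. \<phi> p - \<psi> p)"
proof -
  show "smooth_on U (\<lambda>p. \<phi> p + \<psi> p)" "smooth_on U (\<lambda>p. \<phi> p * \<psi> p)"
    using assms by (simp_all add: smooth_on_def C_on_add C_on_mult)
  have "smooth_on U (\<lambda>p. \<phi> p + (- 1) * \<psi> p)"
    using assms by (simp only: smooth_on_def C_on_add C_on_mult C_on_const simp_thms)
  then show "smooth_on U (\<lambda>p. \<phi> p - \<psi> p)" by simp
qed

lemma smooth_on_minus: "open U \<Longrightarrow> smooth_on U \<phi> \<Longrightarrow> smooth_on U (\<lambda>p. - \<phi> p)"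
  using smooth_on_diff[OF _ smooth_on_const, of U \<phi> 0] by simp

lemma smooth_on_sum:
  assumes "open U" "\<And>i. i \<in> I \<Longrightarrow> smooth_on U (\<phi> i)"
  shows "smooth_on U (\<lambda>p. \<Sum>i\<in>I. \<phi> i p)"
  using assms(2)
proof (induction I rule: infinite_finite_induct)
  case (insert i I)
  then show ?case by (simp add: smooth_on_add[OF assms(1)])
qed (simp_all add: smooth_on_const)

lemma smooth_on_pd: "smooth_on U \<phi> \<Longrightarrow> smooth_on U (pd c \<phi>)"
  unfolding smooth_on_def by (intro allI C_on_SucD(3)) simp

lemma smooth_on_pdiff: "smooth_on U \<phi> \<Longrightarrow> p \<in> U \<Longrightarrow> pdiff \<phi> p"
  unfolding smooth_on_def using C_on_SucD(2)[of 0] by blast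

lemma smooth_on_continuous: "smooth_on U \<phi> \<Longrightarrow> continuous_on U \<phi>"
  unfolding smooth_on_def by (metis C_on.simps(1))


section \<open>Symmetry of second partial derivatives\<close>

text \<open>The mean value inequality is used twice: in \<open>t\<close> for
  \<open>f1 s t - t *\<^sub>R L\<close>, then in \<open>s\<close> for
  \<open>f s h - f s 0 - (s * h) *\<^sub>R L\<close>.\<close>

lemma second_difference_bound:
  fixes f :: "real \<Rightarrow> real \<Rightarrow> 'b::real_normed_vector"
  assumes "0 < h" "0 \<le> e"
    and f1: "\<And>s t. 0 \<le> s \<Longrightarrow> s \<le> h \<Longrightarrow> 0 \<le> t \<Longrightarrow> t \<le> h \<Longrightarrow>
          ((\<lambda>s. f s t) has_vector_derivative f1 s t) (at s)"
    and f12: "\<And>s t. 0 \<le> s \<Longrightarrow> s \<le> h \<Longrightarrow> 0 \<le> t \<Longrightarrow> t \<le> h \<Longrightarrow>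
          ((\<lambda>t. f1 s t) has_vector_derivative f12 s t) (at t)"
    and L: "\<And>s t. 0 \<le> s \<Longrightarrow> s \<le> h \<Longrightarrow> 0 \<le> t \<Longrightarrow> t \<le> h \<Longrightarrow> norm (f12 s t - L) \<le> e"
  shows "norm (f h h - f h 0 - (f 0 h - f 0 0) - h\<^sup>2 *\<^sub>R L) \<le> e * h\<^sup>2"
proof -
  have inner: "norm (f1 s h - f1 s 0 - h *\<^sub>R L) \<le> e * h" if s: "0 \<le> s" "s \<le> h" for s
  proof -
    have d: "((\<lambda>t. f1 s t - t *\<^sub>R L) has_vector_derivative f12 s t - L) (at t)"
      if "0 \<le> t" "t \<le> h" for t
      using f12[OF s that] by (auto intro!: derivative_eq_intros)
    have "norm ((f1 s h - h *\<^sub>R L) - (f1 s 0 - 0 *\<^sub>R L)) \<le> e * h - e * 0"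
    proof (rule differentiable_bound_general[OF \<open>0 < h\<close>])
      show "continuous_on {0..h} (\<lambda>t. f1 s t - t *\<^sub>R L)"
        using d by (auto intro!: continuous_at_imp_continuous_on has_vector_derivative_continuous)
      show "((\<lambda>t. e * t) has_vector_derivative e) (at t)" for t
        by (auto intro!: derivative_eq_intros)
      show "((\<lambda>t. f1 s t - t *\<^sub>R L) has_vector_derivative f12 s t - L) (at t)" if "0 < t" "t < h" for t
        using d that by simp
    qed (use L s in \<open>auto intro!: continuous_intros\<close>)
    then show ?thesis by (simp add: algebra_simps)
  qed
  have d: "((\<lambda>s. f s h - f s 0 - (s * h) *\<^sub>R L) has_vector_derivative f1 s h - f1 s 0 - h *\<^sub>R L) (at s)"
    if "0 \<le> s" "s \<le> h" for s
    using f1[of s h] f1[of s 0] that \<open>0 < h\<close> by (auto intro!: derivative_eq_intros)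
  have "norm ((f h h - f h 0 - (h * h) *\<^sub>R L) - (f 0 h - f 0 0 - (0 * h) *\<^sub>R L)) \<le> e * h * h - e * h * 0"
  proof (rule differentiable_bound_general[OF \<open>0 < h\<close>])
    show "continuous_on {0..h} (\<lambda>s. f s h - f s 0 - (s * h) *\<^sub>R L)"
      using d by (auto intro!: continuous_at_imp_continuous_on has_vector_derivative_continuous)
    show "((\<lambda>s. e * h * s) has_vector_derivative e * h) (at s)" for s
      by (auto intro!: derivative_eq_intros)
    show "((\<lambda>s. f s h - f s 0 - (s * h) *\<^sub>R L) has_vector_derivative f1 s h - f1 s 0 - h *\<^sub>R L) (at s)"
      if "0 < s" "s < h" for s
      using d that by simp
  qed (use inner in \<open>auto intro!: continuous_intros\<close>)
  then show ?thesis by (simp add: algebra_simps power2_eq_square)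
qed

text \<open>The field derivative is restricted to real parameters and moved from \<open>0\<close> to
  \<open>s\<close> by additivity of \<open>step\<close>; the mean value argument lives on a real
  square.\<close>

lemma has_vector_derivative_step:
  assumes "pdiff \<phi> (p + step c (of_real s))"
  shows "((\<lambda>s. \<phi> (p + step c (of_real s))) has_vector_derivative pd c \<phi> (p + step c (of_real s))) (at s)"
proof -
  have "((\<lambda>t. \<phi> (p + step c (of_real s) + step c t)) has_field_derivative
      pd c \<phi> (p + step c (of_real s))) (at (of_real (s - s)))"
    using has_pd[OF assms] by simp
  then have "((\<lambda>t. \<phi> (p + step c (of_real s) + step c (t - of_real s))) has_field_derivative
      pd c \<phi> (p + step c (of_real s))) (at (of_real s))"
    using DERIV_shift[of "\<lambda>t. \<phi> (p + step c (of_real s) + step c t)" _ "of_real s" "- of_real s"] by simp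
  then show ?thesis
    by (auto dest: has_vector_derivative_real_field simp: add.assoc simp flip: step_add)
qed

text \<open>Schwarz's theorem: on a small square of side \<open>h\<close>, the second difference
  \<open>D\<close> is within \<open>e / 2 * h\<^sup>2\<close> of \<open>h\<^sup>2\<close> times
  either mixed derivative at \<open>p\<close>, hence these differ by at most
  \<open>e\<close>.\<close>

lemma pd_commute:
  fixes \<phi> :: "('a::real_normed_field, 'n::finite) pt \<Rightarrow> 'a"
  assumes U: "open U" "p \<in> U" and \<phi>: "smooth_on U \<phi>"
  shows "pd c (pd d \<phi>) p = pd d (pd c \<phi>) p"
proof -
  define P :: "real \<Rightarrow> real \<Rightarrow> ('a, 'n) pt"
    where "P s t = p + step c (of_real s) + step d (of_real t)" for s t
  have close: "\<exists>\<delta>>0. \<forall>s t. 0 \<le> s \<and> s \<le> \<delta> \<and> 0 \<le> t \<and> t \<le> \<delta> \<longrightarrow>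
      P s t \<in> U \<and> norm (pd d (pd c \<phi>) (P s t) - pd d (pd c \<phi>) p) \<le> e \<and>
      norm (pd c (pd d \<phi>) (P s t) - pd c (pd d \<phi>) p) \<le> e" if "0 < e" for e
  proof -
    have cont: "isCont (pd a (pd b \<phi>)) p" for a b
      using smooth_on_continuous[OF smooth_on_pd[OF smooth_on_pd[OF \<phi>]]] U
      by (simp add: continuous_on_eq_continuous_at)
    have "((\<lambda>z. fst z) \<longlongrightarrow> 0) (nhds (0, 0))" "((\<lambda>z. snd z) \<longlongrightarrow> 0) (nhds (0, 0))"
      using tendsto_fst[OF filterlim_ident[of "nhds (0, 0)"]]
        tendsto_snd[OF filterlim_ident[of "nhds (0, 0)"]] by simp_all
    then have "((\<lambda>z. P (fst z) (snd z)) \<longlongrightarrow> P 0 0) (nhds (0, 0))"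
      unfolding P_def by (intro tendsto_add tendsto_const tendsto_step tendsto_of_real)
    then have P: "((\<lambda>z. P (fst z) (snd z)) \<longlongrightarrow> p) (nhds (0, 0))" by (simp add: P_def)
    have lim: "\<forall>\<^sub>F z in nhds (0, 0). P (fst z) (snd z) \<in> U"
      "((\<lambda>z. pd a (pd b \<phi>) (P (fst z) (snd z))) \<longlongrightarrow> pd a (pd b \<phi>) p) (nhds (0, 0))" for a b
      using topological_tendstoD[OF P U] isCont_tendsto_compose[OF cont P] by simp_all
    have "\<forall>\<^sub>F z in nhds (0, 0). P (fst z) (snd z) \<in> U \<and>
      norm (pd d (pd c \<phi>) (P (fst z) (snd z)) - pd d (pd c \<phi>) p) < e \<and>
      norm (pd c (pd d \<phi>) (P (fst z) (snd z)) - pd c (pd d \<phi>) p) < e"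
      using lim(1) tendstoD[OF lim(2) that] tendstoD[OF lim(2) that]
      by (simp add: eventually_conj_iff dist_norm)
    then obtain r where r: "r > 0" "\<And>z. dist z (0, 0) < r \<Longrightarrow> P (fst z) (snd z) \<in> U \<and>
      norm (pd d (pd c \<phi>) (P (fst z) (snd z)) - pd d (pd c \<phi>) p) < e \<and>
      norm (pd c (pd d \<phi>) (P (fst z) (snd z)) - pd c (pd d \<phi>) p) < e"
      unfolding eventually_nhds_metric by blast
    \<comment> \<open>With side \<open>r / 3\<close> the distance to the corner is at most
      \<open>2 * r / 3\<close>.\<close>
    have "dist (s, t) (0, 0) < r" if "0 \<le> s" "s \<le> r / 3" "0 \<le> t" "t \<le> r / 3" for s t :: real
    proof -
      have "dist (s, t) (0, 0) \<le> \<bar>s\<bar> + \<bar>t\<bar>"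
        using sqrt_sum_squares_le_sum_abs[of s t] by (simp add: dist_Pair_Pair)
      then show ?thesis using that r(1) by simp
    qed
    then show ?thesis
      using r by (intro exI[of _ "r / 3"]) (force intro: less_imp_le)
  qed
  have "norm (pd d (pd c \<phi>) p - pd c (pd d \<phi>) p) \<le> e" if e: "0 < e" for e
  proof -
    obtain h where h: "h > 0" and
      hP: "\<And>s t. 0 \<le> s \<Longrightarrow> s \<le> h \<Longrightarrow> 0 \<le> t \<Longrightarrow> t \<le> h \<Longrightarrow>
      P s t \<in> U \<and> norm (pd d (pd c \<phi>) (P s t) - pd d (pd c \<phi>) p) \<le> e / 2 \<and>
      norm (pd c (pd d \<phi>) (P s t) - pd c (pd d \<phi>) p) \<le> e / 2"
      using close[OF half_gt_zero[OF e]] by blast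
    have dc: "((\<lambda>s. \<psi> (P s t)) has_vector_derivative pd c \<psi> (P s t)) (at s)"
      and dd: "((\<lambda>t. \<psi> (P s t)) has_vector_derivative pd d \<psi> (P s t)) (at t)"
      if "smooth_on U \<psi>" "P s t \<in> U" for s t \<psi>
      using has_vector_derivative_step[of \<psi> "p + step d (of_real t)" c s]
        has_vector_derivative_step[of \<psi> "p + step c (of_real s)" d t] smooth_on_pdiff[OF that]
      by (simp_all add: P_def ac_simps)
    define D where "D = \<phi> (P h h) - \<phi> (P h 0) - (\<phi> (P 0 h) - \<phi> (P 0 0))"
    have 1: "norm (D - h\<^sup>2 *\<^sub>R pd d (pd c \<phi>) p) \<le> e / 2 * h\<^sup>2"
      unfolding D_def
      by (rule second_difference_bound[of h "e / 2" "\<lambda>s t. \<phi> (P s t)" "\<lambda>s t. pd c \<phi> (P s t)"])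
        (use h hP e in \<open>auto intro!: dc dd \<phi> smooth_on_pd[OF \<phi>]\<close>)
    \<comment> \<open>The second difference is symmetric in its two parameters, so the bound applies
      again with \<open>c\<close> and \<open>d\<close> exchanged.\<close>
    have "norm (\<phi> (P h h) - \<phi> (P 0 h) - (\<phi> (P h 0) - \<phi> (P 0 0)) - h\<^sup>2 *\<^sub>R pd c (pd d \<phi>) p) \<le> e / 2 * h\<^sup>2"
      by (rule second_difference_bound[of h "e / 2" "\<lambda>s t. \<phi> (P t s)" "\<lambda>s t. pd d \<phi> (P t s)"])
        (use h hP e in \<open>auto intro!: dc dd \<phi> smooth_on_pd[OF \<phi>]\<close>)
    then have 2: "norm (D - h\<^sup>2 *\<^sub>R pd c (pd d \<phi>) p) \<le> e / 2 * h\<^sup>2"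
      by (simp add: D_def algebra_simps)
    have "h\<^sup>2 * norm (pd d (pd c \<phi>) p - pd c (pd d \<phi>) p) =
      norm ((D - h\<^sup>2 *\<^sub>R pd c (pd d \<phi>) p) - (D - h\<^sup>2 *\<^sub>R pd d (pd c \<phi>) p))"
      using norm_scaleR[of "h\<^sup>2" "pd d (pd c \<phi>) p - pd c (pd d \<phi>) p"] by (simp add: scaleR_diff_right)
    also have "\<dots> \<le> h\<^sup>2 * e"
      using norm_triangle_ineq4[of "D - h\<^sup>2 *\<^sub>R pd c (pd d \<phi>) p" "D - h\<^sup>2 *\<^sub>R pd d (pd c \<phi>) p"] 1 2
      by (simp add: algebra_simps)
    finally show ?thesis using h by simp
  qed
  then have "norm (pd d (pd c \<phi>) p - pd c (pd d \<phi>) p) \<le> 0"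
    using field_le_epsilon[of "norm (pd d (pd c \<phi>) p - pd c (pd d \<phi>) p)" 0] by simp
  then show ?thesis by simp
qed

section \<open>The bracket of the coordinates\<close>

definition sg :: "'n::linorder \<Rightarrow> 'n \<Rightarrow> 'a::ring_1" where
  "sg i j = (if j < i then 1 else if i < j then - 1 else 0)"

lemma sg_self [simp]: "sg i i = 0"
  by (simp add: sg_def)

lemma sg_swap: "sg j i = - sg i j"
  by (auto simp: sg_def)

text \<open>This is the modified classical Yang--Baxter equation for \<open>r12\<close>.\<close>

lemma sg_cycle:
  "sg a b * sg b c + sg b c * sg c a + sg c a * sg a b = (if a = b \<and> b = c then 0 else - (1::'a::ring_1))"
  by (auto simp: sg_def)

text \<open>The Hamiltonian vector field of the entry \<open>F\<^sub>k\<^sub>l\<close> is the infinitesimal action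
  \<open>B \<mapsto> B M\<close>, \<open>F \<mapsto> - (M F + F M\<^sup>T)\<close> of the following matrix \<open>M\<close>.\<close>

definition ham :: "('a::ring_1, 'n::{finite,linorder}) mat \<Rightarrow> 'n \<Rightarrow> 'n \<Rightarrow> ('a, 'n) mat" where
  "ham F k l = (\<chi> a j. (if j = k then (1 + sg a k) * F $ a $ l else 0)
                      - (if j = l then (1 + sg l a) * F $ k $ a else 0))"

section \<open>Entries of the r-matrix and of the brackets between coordinates\<close>

lemma sum_Times_UNIV: "(\<Sum>x\<in>UNIV. f x) = (\<Sum>a\<in>UNIV. \<Sum>b\<in>UNIV. f (a, b))"
  for f :: "'b::finite \<times> 'c::finite \<Rightarrow> 'd::comm_monoid_add"
  by (simp add: sum.cartesian_product)

lemma if_conj_zero: "(if P \<and> Q then x else 0) = (if P then if Q then x else 0 else 0)"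
  by simp

lemma sum_if_zero: "(\<Sum>b\<in>A. if P then f b else 0) = (if P then sum f A else 0)"
  by simp

lemmas delta_simps = if_distrib[of "\<lambda>x. x * _"] if_distrib[of "\<lambda>x. _ * x"] if_conj_zero sum_if_zero

lemma tensor_elem_mat_entry:
  "(elem_mat a b s \<otimes>\<^sub>m elem_mat c d t) $ (i, k) $ (j, l) =
     (if i = a \<and> j = b \<and> k = c \<and> l = d then s * t else (0::'a::semiring_0))"
  by (simp add: tensor_def elem_mat_def)

text \<open>The coefficient of \<open>E\<^sub>i\<^sub>j\<close> tensor
  \<open>E\<^sub>j\<^sub>i\<close> is 2, 1 or 0 for \<open>i > j\<close>, \<open>i = j\<close>,
  \<open>i < j\<close>, which is \<open>1 + sg i j\<close>. Thus \<open>r12\<close> is the flip of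
  the tensor factors with weights.\<close>

lemma r12_entry:
  "(r12 :: ('a::real_normed_field, 'n::{finite,linorder}) mat2) $ (i, k) $ (j, l) =
     (if i = l \<and> k = j then 1 + sg i j else 0)"
proof -
  define E where "E a b = (elem_mat a b 1 \<otimes>\<^sub>m elem_mat b a 1 :: ('a, 'n) mat2) $ (i, k) $ (j, l)" for a b
  have E: "E a b = (if (a, b) = (i, j) then if i = l \<and> k = j then 1 else 0 else 0)" for a b
    unfolding E_def tensor_elem_mat_entry by auto
  have "(\<Sum>a\<in>UNIV. E a a) = (\<Sum>a\<in>UNIV. if a = i then if i = l \<and> k = j \<and> i = j then 1 else 0 else 0)"
    by (intro sum.cong) (auto simp: E)
  moreover have "(\<Sum>x\<in>{(a, b). b < a}. E (fst x) (snd x)) =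
      (\<Sum>x\<in>{(a, b). b < a}. if x = (i, j) then if i = l \<and> k = j then 1 else 0 else 0)"
    by (intro sum.cong) (auto simp: E)
  ultimately have
    "(\<Sum>a\<in>UNIV. E a a) = (if i = l \<and> k = j \<and> i = j then 1 else 0)"
    "(\<Sum>x\<in>{(a, b). b < a}. E (fst x) (snd x)) = (if i = l \<and> k = j \<and> j < i then 1 else 0)"
    unfolding sum.delta[OF finite] by simp_all
  then show ?thesis
    unfolding r12_def E_def vector_add_component vector_scaleR_component sum_component
    by (cases "i = l \<and> k = j") (auto simp: sg_def case_prod_beta scaleR_2)
qed

text \<open>Each row and each column of \<open>r12\<close> has at most one nonzero entry, so
  multiplication by it swaps two indices and scales.\<close>

lemma r12_mult: "(r12 ** X) $ (i, k) $ (j, l) = (1 + sg i k) * X $ (k, i) $ (j, l)"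
  and mult_r12: "(X ** r12) $ (i, k) $ (j, l) = X $ (i, k) $ (l, j) * (1 + sg l j)"
proof -
  have 1: "r12 $ (i, k) $ x * X $ x $ (j, l) =
      (if x = (k, i) then (1 + sg i k) * X $ (k, i) $ (j, l) else 0)" for x
    by (cases x) (auto simp: r12_entry)
  show "(r12 ** X) $ (i, k) $ (j, l) = (1 + sg i k) * X $ (k, i) $ (j, l)"
    by (simp add: matrix_matrix_mult_def 1)
  have 2: "X $ (i, k) $ x * r12 $ x $ (j, l) =
      (if x = (l, j) then X $ (i, k) $ (l, j) * (1 + sg l j) else 0)" for x
    by (cases x) (auto simp: r12_entry)
  show "(X ** r12) $ (i, k) $ (j, l) = X $ (i, k) $ (l, j) * (1 + sg l j)"
    by (simp add: matrix_matrix_mult_def 2)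
qed

lemma transpose1_r12_entry:
  "transpose1 r12 $ (i, k) $ (j, l) = (if i = k \<and> j = l then 1 + sg j i else 0)"
  by (auto simp: transpose1_def r12_entry)

lemma leg_mult:
  fixes X :: "('a::semiring_1, 'n::finite) mat"
  shows "(leg1 X ** T) $ (i, k) $ (j, l) = (\<Sum>a\<in>UNIV. X $ i $ a * T $ (a, k) $ (j, l))"
    and "(leg2 X ** T) $ (i, k) $ (j, l) = (\<Sum>a\<in>UNIV. X $ k $ a * T $ (i, a) $ (j, l))"
    and "(T ** leg1 X) $ (i, k) $ (j, l) = (\<Sum>a\<in>UNIV. T $ (i, k) $ (a, l) * X $ a $ j)"
    and "(T ** leg2 X) $ (i, k) $ (j, l) = (\<Sum>a\<in>UNIV. T $ (i, k) $ (j, a) * X $ a $ l)"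
  by (simp_all add: matrix_matrix_mult_def leg1_def leg2_def tensor_def mat_def sum_Times_UNIV
      delta_simps cong: if_cong)

lemma leg1_leg2: "(leg1 X ** leg2 Y) $ (i, k) $ (j, l) = X $ i $ j * Y $ k $ l"
  by (simp add: leg_mult leg2_def tensor_def mat_def
      delta_simps cong: if_cong)

lemma r12_leg1_leg2: "(r12 ** leg1 X ** leg2 Y) $ (i, k) $ (j, l) = (1 + sg i k) * (X $ k $ j * Y $ i $ l)"
  by (simp add: r12_mult leg1_leg2 flip: matrix_mul_assoc)

text \<open>Both products contain the same monomial; the summands 1 of the weights cancel and only
  the signs remain.\<close>

lemma brBB_entry:
  fixes p :: "('a::real_normed_field, 'n::{finite,linorder}) pt"
  shows "brBB p $ (i, k) $ (j, l) = (sg i k + sg j l) * (snd p $ k $ j * snd p $ i $ l)"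
proof -
  have "brBB (F, B) $ (i, k) $ (j, l) = (sg i k + sg j l) * (B $ k $ j * B $ i $ l)"
    for F B :: "('a, 'n) mat"
    by (simp add: r12_leg1_leg2 mult_r12 leg1_leg2 sg_swap[of l j]) (simp add: algebra_simps)
  then show ?thesis by (metis prod.collapse)
qed

lemma brBF_entry:
  fixes p :: "('a::real_normed_field, 'n::{finite,linorder}) pt"
  shows "brBF p $ (i, k) $ (j, l) = (snd p ** ham (fst p) k l) $ i $ j"
proof -
  have "(leg1 B ** r12 ** leg2 F) $ (i, k) $ (j, l) =
      (\<Sum>a\<in>UNIV. B $ i $ a * (if j = k then (1 + sg a k) * F $ a $ l else 0))" for F B :: "('a, 'n) mat"
    by (auto simp: leg_mult r12_entry delta_simps ac_simps
        simp flip: matrix_mul_assoc cong: if_cong)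
  moreover have "(leg1 B ** leg2 F ** transpose1 r12) $ (i, k) $ (j, l) =
      (\<Sum>a\<in>UNIV. B $ i $ a * (if j = l then (1 + sg l a) * F $ k $ a else 0))" for F B :: "('a, 'n) mat"
    by (auto simp: leg_mult transpose1_r12_entry delta_simps ac_simps
        simp flip: matrix_mul_assoc cong: if_cong)
  ultimately have "brBF (F, B) $ (i, k) $ (j, l) = (B ** ham F k l) $ i $ j" for F B :: "('a, 'n) mat"
    by (simp add: matrix_matrix_mult_def ham_def sum_subtractf right_diff_distrib)
  then show ?thesis by (metis prod.collapse)
qed

lemma brFF_entry:
  fixes p :: "('a::real_normed_field, 'n::{finite,linorder}) pt"
  shows "brFF p $ (i, k) $ (j, l) =
     - (sg i k + sg j l) * (fst p $ k $ j * fst p $ i $ l)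
     - (1 + sg j k) * (fst p $ i $ k * fst p $ j $ l) + (1 + sg l i) * (fst p $ k $ i * fst p $ l $ j)"
proof -
  have "(leg1 F ** transpose1 r12 ** leg2 F) $ (i, k) $ (j, l) = (1 + sg j k) * (F $ i $ k * F $ j $ l)"
    and "(leg2 F ** transpose1 r12 ** leg1 F) $ (i, k) $ (j, l) = (1 + sg l i) * (F $ k $ i * F $ l $ j)"
    for F :: "('a, 'n) mat"
    by (auto simp: leg_mult transpose1_r12_entry delta_simps ac_simps
        simp flip: matrix_mul_assoc cong: if_cong)
  then have "brFF (F, B) $ (i, k) $ (j, l) = - (sg i k + sg j l) * (F $ k $ j * F $ i $ l)
     - (1 + sg j k) * (F $ i $ k * F $ j $ l) + (1 + sg l i) * (F $ k $ i * F $ l $ j)" for F B :: "('a, 'n) mat"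
    by (simp add: r12_leg1_leg2 mult_r12 leg1_leg2 sg_swap[of l j]) (simp add: algebra_simps)
  then show ?thesis by (metis prod.collapse)
qed

lemma ham_action_entry:
  fixes F :: "('a::comm_ring_1, 'n::{finite,linorder}) mat"
  shows "(- (ham F k l ** F + F ** transpose (ham F k l))) $ i $ j =
     - (sg i k + sg j l) * (F $ k $ j * F $ i $ l)
     - (1 + sg j k) * (F $ i $ k * F $ j $ l) + (1 + sg l i) * (F $ k $ i * F $ l $ j)"
  by (simp add: matrix_matrix_mult_def ham_def transpose_def sum_subtractf left_diff_distrib
      right_diff_distrib delta_simps sg_swap[of l j] cong: if_cong)
    (simp add: algebra_simps)

text \<open>Two of the four terms of the action share the monomial
  \<open>F $ k $ j * F $ i $ l\<close>; their weights combine to the sum of signs in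
  \<open>brFF\<close>.\<close>

lemma brFF_eq_ham:
  fixes p :: "('a::real_normed_field, 'n::{finite,linorder}) pt"
  shows "brFF p $ (i, k) $ (j, l) = (- (ham (fst p) k l ** fst p + fst p ** transpose (ham (fst p) k l))) $ i $ j"
  by (simp only: brFF_entry ham_action_entry)

section \<open>The bracket as a bivector field, and its derivation rules\<close>

lemma coord_eq: "coord (True, i, j) = (\<lambda>q. fst q $ i $ j)" "coord (False, i, j) = (\<lambda>q. snd q $ i $ j)"
  by (simp_all add: fun_eq_iff)

text \<open>The Poisson tensor as one skew matrix indexed by all coordinates, so that general
  arguments need not distinguish the four blocks.\<close>

fun bivec :: "'n coord \<Rightarrow> 'n coord \<Rightarrow> ('a::real_normed_field, 'n::{finite,linorder}) pt \<Rightarrow> 'a" where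
  "bivec (False, i, j) (False, k, l) p = brBB p $ (i, k) $ (j, l)"
| "bivec (False, i, j) (True, k, l) p = brBF p $ (i, k) $ (j, l)"
| "bivec (True, k, l) (False, i, j) p = - brBF p $ (i, k) $ (j, l)"
| "bivec (True, i, j) (True, k, l) p = brFF p $ (i, k) $ (j, l)"

lemma bivec_skew: "bivec c d p = - bivec d c p"
proof -
  obtain b i j b' k l where cd: "c = (b, i, j)" "d = (b', k, l)"
    by (cases c; cases d)
  show ?thesis
    unfolding cd
    by (cases b; cases b')
      (simp_all add: brBB_entry brFF_entry sg_swap[of k i] sg_swap[of l j], simp_all add: algebra_simps)
qed

lemma sum_coord:
  "(\<Sum>c\<in>UNIV. f c) = (\<Sum>i\<in>UNIV. \<Sum>j\<in>UNIV. f (False, i, j) + f (True, i, j))"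
  for f :: "'n::finite coord \<Rightarrow> 'b::comm_monoid_add"
  by (simp add: sum_Times_UNIV UNIV_bool sum.distrib)

lemma Omega_bivec:
  "Omega \<phi> \<psi> p = (\<Sum>c\<in>UNIV. \<Sum>d\<in>UNIV. bivec c d p * (pd c \<phi> p * pd d \<psi> p))"
proof -
  \<comment> \<open>\<open>FB\<close> is the subtracted mixed term. In the bivector form its sums
    over \<open>k\<close>, \<open>l\<close> come first, so the index pairs are bundled and exchanged
    in one swap.\<close>
  define FB where "FB i j k l = brBF p $ (i, k) $ (j, l) * (dF k l \<phi> p * dB i j \<psi> p)" for i j k l
  have "(\<Sum>k\<in>UNIV. \<Sum>l\<in>UNIV. \<Sum>i\<in>UNIV. \<Sum>j\<in>UNIV. FB i j k l) =
      (\<Sum>y\<in>UNIV. \<Sum>x\<in>UNIV. FB (fst x) (snd x) (fst y) (snd y))"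
    by (simp add: sum_Times_UNIV)
  also have "\<dots> = (\<Sum>i\<in>UNIV. \<Sum>j\<in>UNIV. \<Sum>k\<in>UNIV. \<Sum>l\<in>UNIV. FB i j k l)"
    by (subst sum.swap) (simp add: sum_Times_UNIV)
  finally have swap: "(\<Sum>k\<in>UNIV. \<Sum>l\<in>UNIV. \<Sum>i\<in>UNIV. \<Sum>j\<in>UNIV. FB i j k l) =
      (\<Sum>i\<in>UNIV. \<Sum>j\<in>UNIV. \<Sum>k\<in>UNIV. \<Sum>l\<in>UNIV. FB i j k l)" .
  show ?thesis
    unfolding Omega_def sum_coord bivec.simps pd_dF pd_dB
    using swap by (simp add: sum.distrib sum_subtractf sum_negf algebra_simps FB_def)
qed

lemma Omega_skew: "Omega \<phi> \<psi> p = - Omega \<psi> \<phi> p"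
proof -
  have "Omega \<phi> \<psi> p = (\<Sum>d\<in>UNIV. \<Sum>c\<in>UNIV. bivec c d p * (pd c \<phi> p * pd d \<psi> p))"
    unfolding Omega_bivec by (rule sum.swap)
  also have "\<dots> = (\<Sum>d\<in>UNIV. \<Sum>c\<in>UNIV. - (bivec d c p * (pd d \<psi> p * pd c \<phi> p)))"
    by (intro sum.cong refl, subst bivec_skew) (simp add: ac_simps)
  finally show ?thesis
    unfolding Omega_bivec by (simp add: sum_negf)
qed

text \<open>For fixed \<open>\<phi>\<close> the bracket is a first-order differential operator in
  the second slot. Its rules there follow from those of \<open>pd\<close>, and the rules in the
  first slot follow by skewness.\<close>

lemma Omega_bivec_right: "Omega \<phi> \<psi> p = (\<Sum>d\<in>UNIV. (\<Sum>c\<in>UNIV. bivec c d p * pd c \<phi> p) * pd d \<psi> p)"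
  unfolding Omega_bivec by (subst sum.swap) (simp add: sum_distrib_right mult.assoc)

lemma Omega_coord: "Omega (coord c) (coord d) p = bivec c d p"
  unfolding Omega_bivec_right pd_coord by (simp add: if_distrib[of "\<lambda>x. _ * x"] cong: if_cong)

lemma Omega_const_right: "Omega \<phi> (\<lambda>_. k) p = 0"
  by (simp add: Omega_bivec pd_const)

lemma
  assumes "pdiff \<psi> p" "pdiff \<theta> p"
  shows Omega_add_right: "Omega \<phi> (\<lambda>q. \<psi> q + \<theta> q) p = Omega \<phi> \<psi> p + Omega \<phi> \<theta> p"
    and Omega_diff_right: "Omega \<phi> (\<lambda>q. \<psi> q - \<theta> q) p = Omega \<phi> \<psi> p - Omega \<phi> \<theta> p"
    and Omega_mult_right: "Omega \<phi> (\<lambda>q. \<psi> q * \<theta> q) p = Omega \<phi> \<psi> p * \<theta> p + \<psi> p * Omega \<phi> \<theta> p"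
  unfolding Omega_bivec_right pd_add[OF assms] pd_diff[OF assms] pd_mult[OF assms]
  by (simp_all add: sum.distrib sum_subtractf sum_distrib_left sum_distrib_right algebra_simps)

lemma Omega_minus_right: "pdiff \<psi> p \<Longrightarrow> Omega \<phi> (\<lambda>q. - \<psi> q) p = - Omega \<phi> \<psi> p"
  unfolding Omega_bivec_right by (simp add: pd_minus sum_negf)

lemma Omega_sum_right:
  assumes "\<And>i. i \<in> I \<Longrightarrow> pdiff (\<psi> i) p"
  shows "Omega \<phi> (\<lambda>q. \<Sum>i\<in>I. \<psi> i q) p = (\<Sum>i\<in>I. Omega \<phi> (\<psi> i) p)"
proof -
  have "Omega \<phi> (\<lambda>q. \<Sum>i\<in>I. \<psi> i q) p =
      (\<Sum>d\<in>UNIV. \<Sum>i\<in>I. (\<Sum>c\<in>UNIV. bivec c d p * pd c \<phi> p) * pd d (\<psi> i) p)"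
    unfolding Omega_bivec_right by (simp add: pd_sum assms sum_distrib_left)
  also have "\<dots> = (\<Sum>i\<in>I. Omega \<phi> (\<psi> i) p)"
    unfolding Omega_bivec_right by (rule sum.swap)
  finally show ?thesis .
qed

lemma
  assumes "pdiff \<psi> p" "pdiff \<theta> p"
  shows Omega_add_left: "Omega (\<lambda>q. \<psi> q + \<theta> q) \<phi> p = Omega \<psi> \<phi> p + Omega \<theta> \<phi> p"
    and Omega_diff_left: "Omega (\<lambda>q. \<psi> q - \<theta> q) \<phi> p = Omega \<psi> \<phi> p - Omega \<theta> \<phi> p"
    and Omega_mult_left: "Omega (\<lambda>q. \<psi> q * \<theta> q) \<phi> p = Omega \<psi> \<phi> p * \<theta> p + \<psi> p * Omega \<theta> \<phi> p"
  using Omega_add_right[OF assms, of \<phi>] Omega_diff_right[OF assms, of \<phi>] Omega_mult_right[OF assms, of \<phi>]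
  by (simp_all add: Omega_skew[of _ \<phi>])

lemma Omega_const_left: "Omega (\<lambda>_. k) \<phi> p = 0"
  by (simp add: Omega_bivec pd_const)

lemma Omega_minus_left: "pdiff \<psi> p \<Longrightarrow> Omega (\<lambda>q. - \<psi> q) \<phi> p = - Omega \<psi> \<phi> p"
  using Omega_minus_right[of \<psi> p \<phi>] by (simp add: Omega_skew[of _ \<phi>])

lemma Omega_sum_left:
  assumes "\<And>i. i \<in> I \<Longrightarrow> pdiff (\<psi> i) p"
  shows "Omega (\<lambda>q. \<Sum>i\<in>I. \<psi> i q) \<phi> p = (\<Sum>i\<in>I. Omega (\<psi> i) \<phi> p)"
  using Omega_sum_right[of I \<psi> p \<phi>] assms by (simp add: Omega_skew[of _ \<phi>] sum_negf)

text \<open>All brackets of coordinates are quadratic polynomials in the coordinates.\<close>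

lemma smooth_on_bivec: "open U \<Longrightarrow> smooth_on U (bivec c d)"
proof -
  assume U: "open U"
  have B: "smooth_on U (\<lambda>p. snd p $ i $ j)" and F: "smooth_on U (\<lambda>p. fst p $ i $ j)" for i j
    using smooth_on_coord[of U "(False, i, j)"] smooth_on_coord[of U "(True, i, j)"] by (simp_all add: coord_eq)
  note intros = smooth_on_add[OF U] smooth_on_diff[OF U] smooth_on_mult[OF U] smooth_on_sum[OF U]
    smooth_on_minus[OF U] smooth_on_const B F
  have ham: "smooth_on U (\<lambda>p. ham (fst p) k l $ a $ j)" for k l a j
    unfolding ham_def by (cases "j = k"; cases "j = l") (auto intro!: intros)
  have 1: "smooth_on U (\<lambda>p. brBB p $ (i, k) $ (j, l))" for i j k l
    unfolding brBB_entry by (intro intros)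
  have 2: "smooth_on U (\<lambda>p. brBF p $ (i, k) $ (j, l))" for i j k l
    unfolding brBF_entry matrix_matrix_mult_def by (auto intro!: intros ham)
  have 3: "smooth_on U (\<lambda>p. brFF p $ (i, k) $ (j, l))" for i j k l
    unfolding brFF_entry by (intro intros)
  have 4: "smooth_on U (\<lambda>p. - brBF p $ (i, k) $ (j, l))" for i j k l
    by (intro smooth_on_minus[OF U] 2)
  obtain b i j b' k l where cd: "c = (b, i, j)" "d = (b', k, l)"
    by (cases c; cases d)
  have "smooth_on U (\<lambda>p. bivec c d p)"
    unfolding cd using 1 2 3 4 by (cases b; cases b') simp_all
  then show ?thesis by simp
qed

lemma smooth_on_Omega:
  assumes "open U" "smooth_on U \<phi>" "smooth_on U \<psi>"
  shows "smooth_on U (Omega \<phi> \<psi>)"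
proof -
  have "smooth_on U (\<lambda>p. \<Sum>c\<in>UNIV. \<Sum>d\<in>UNIV. bivec c d p * (pd c \<phi> p * pd d \<psi> p))"
    by (intro smooth_on_sum smooth_on_mult smooth_on_bivec smooth_on_pd assms)
  then show ?thesis by (simp add: Omega_bivec[abs_def])
qed

lemma pdiff_bivec: "pdiff (bivec c d) p"
  by (rule smooth_on_pdiff[OF smooth_on_bivec[OF open_UNIV] UNIV_I])


section \<open>Reduction of the Jacobi identity to the coordinates\<close>

definition jac where
  "jac \<phi> \<psi> \<theta> p = Omega \<phi> (Omega \<psi> \<theta>) p + Omega \<psi> (Omega \<theta> \<phi>) p + Omega \<theta> (Omega \<phi> \<psi>) p"

lemma sum_rotate:
  "(\<Sum>a\<in>A. \<Sum>b\<in>B. \<Sum>c\<in>C. f a b c) = (\<Sum>b\<in>B. \<Sum>c\<in>C. \<Sum>a\<in>A. f a b c)"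
proof -
  have "(\<Sum>a\<in>A. \<Sum>b\<in>B. \<Sum>c\<in>C. f a b c) = (\<Sum>b\<in>B. \<Sum>a\<in>A. \<Sum>c\<in>C. f a b c)"
    by (rule sum.swap)
  also have "\<dots> = (\<Sum>b\<in>B. \<Sum>c\<in>C. \<Sum>a\<in>A. f a b c)"
    by (intro sum.cong refl sum.swap)
  finally show ?thesis .
qed

text \<open>The terms with second derivatives cancel in pairs, because \<open>bivec\<close> is skew and second
  partial derivatives commute.\<close>

lemma jac_coord:
  fixes \<phi> \<psi> \<theta> :: "('a::real_normed_field, 'n::{finite,linorder}) pt \<Rightarrow> 'a"
  assumes U: "open U" "p \<in> U" and sm: "smooth_on U \<phi>" "smooth_on U \<psi>" "smooth_on U \<theta>"
  shows "jac \<phi> \<psi> \<theta> p = (\<Sum>a\<in>UNIV. \<Sum>b\<in>UNIV. \<Sum>c\<in>UNIV.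
      (pd a \<phi> p * pd b \<psi> p * pd c \<theta> p) * jac (coord a) (coord b) (coord c) p)"
proof -
  define K where "K a b c = Omega (coord a) (bivec b c) p" for a b c
  define P where "P a b = bivec a b p" for a b
  \<comment> \<open>The outer bracket differentiates a product of three factors: \<open>T\<close>
    collects the derivatives of the Poisson tensor, \<open>A\<close> and \<open>B\<close> the second
    derivatives of the first and second inner function.\<close>
  define T where "T x y z = (\<Sum>a\<in>UNIV. \<Sum>b\<in>UNIV. \<Sum>c\<in>UNIV. (pd a x p * pd b y p * pd c z p) * K a b c)"
    for x y z
  define A where "A x y z = (\<Sum>a\<in>UNIV. \<Sum>b\<in>UNIV. \<Sum>c\<in>UNIV. \<Sum>d\<in>UNIV.
      P a d * P b c * (pd a x p * pd d (pd b y) p * pd c z p))" for x y z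
  define B where "B x y z = (\<Sum>a\<in>UNIV. \<Sum>b\<in>UNIV. \<Sum>c\<in>UNIV. \<Sum>d\<in>UNIV.
      P a d * P b c * (pd a x p * pd b y p * pd d (pd c z) p))" for x y z
  have nested: "Omega x (Omega y z) p = T x y z + A x y z + B x y z"
    if y: "smooth_on U y" and z: "smooth_on U z" for x y z
  proof -
    note s = smooth_on_pdiff[OF smooth_on_pd[OF y] U(2)] smooth_on_pdiff[OF smooth_on_pd[OF z] U(2)]
    have O: "Omega (coord a) w p = (\<Sum>d\<in>UNIV. P a d * pd d w p)" for a w
      unfolding Omega_bivec_right P_def by (simp add: pd_coord if_distrib[of "\<lambda>t. _ * t"] cong: if_cong)
    have D: "Omega x w p = (\<Sum>a\<in>UNIV. pd a x p * Omega (coord a) w p)" for w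
      unfolding O unfolding Omega_bivec P_def by (simp add: sum_distrib_left ac_simps)
    have yz: "Omega y z = (\<lambda>q. \<Sum>b\<in>UNIV. \<Sum>c\<in>UNIV. bivec b c q * (pd b y q * pd c z q))"
      by (rule ext) (rule Omega_bivec)
    have "Omega (coord a) (Omega y z) p = (\<Sum>b\<in>UNIV. \<Sum>c\<in>UNIV.
        Omega (coord a) (\<lambda>q. bivec b c q * (pd b y q * pd c z q)) p)" for a
      unfolding yz by (simp add: Omega_sum_right pdiff_sum pdiff_mult pdiff_bivec s)
    also have "\<dots> a = (\<Sum>b\<in>UNIV. \<Sum>c\<in>UNIV. (pd b y p * pd c z p) * K a b c
       + (\<Sum>d\<in>UNIV. P a d * P b c * (pd d (pd b y) p * pd c z p))
       + (\<Sum>d\<in>UNIV. P a d * P b c * (pd b y p * pd d (pd c z) p)))" for a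
      by (simp add: Omega_mult_right pdiff_mult pdiff_bivec s K_def)
        (simp add: O P_def sum_distrib_left sum_distrib_right algebra_simps)
    finally show ?thesis
      unfolding D T_def A_def B_def
      by (simp add: sum.distrib sum_distrib_left algebra_simps)
  qed
  \<comment> \<open>Both sides contain the second derivatives of \<open>y\<close>. The bound indices
    are renamed until the summands agree up to the sign from \<open>bivec_skew\<close>, then the
    sums are reordered.\<close>
  have AB: "B z x y = - A x y z" if "smooth_on U y" for x y z
  proof -
    have "B z x y = (\<Sum>c\<in>UNIV. \<Sum>a\<in>UNIV. \<Sum>d\<in>UNIV. \<Sum>b\<in>UNIV.
        P c b * P a d * (pd c z p * pd a x p * pd b (pd d y) p))"
      unfolding B_def ..
    also have "\<dots> = (\<Sum>c\<in>UNIV. \<Sum>a\<in>UNIV. \<Sum>d\<in>UNIV. \<Sum>b\<in>UNIV.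
        - (P a d * P b c * (pd a x p * pd d (pd b y) p * pd c z p)))"
    proof (intro sum.cong refl)
      fix c a d b
      show "P c b * P a d * (pd c z p * pd a x p * pd b (pd d y) p) =
        - (P a d * P b c * (pd a x p * pd d (pd b y) p * pd c z p))"
        using bivec_skew[of c b p] pd_commute[OF U that, of b d] by (simp add: P_def)
    qed
    also have "\<dots> = (\<Sum>a\<in>UNIV. \<Sum>d\<in>UNIV. \<Sum>c\<in>UNIV. \<Sum>b\<in>UNIV.
        - (P a d * P b c * (pd a x p * pd d (pd b y) p * pd c z p)))"
      by (rule sum_rotate)
    also have "\<dots> = (\<Sum>a\<in>UNIV. \<Sum>c\<in>UNIV. \<Sum>b\<in>UNIV. \<Sum>d\<in>UNIV.
        - (P a d * P b c * (pd a x p * pd d (pd b y) p * pd c z p)))"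
      by (intro sum.cong refl sum_rotate)
    also have "\<dots> = (\<Sum>a\<in>UNIV. \<Sum>b\<in>UNIV. \<Sum>c\<in>UNIV. \<Sum>d\<in>UNIV.
        - (P a d * P b c * (pd a x p * pd d (pd b y) p * pd c z p)))"
      by (intro sum.cong refl sum.swap)
    finally show ?thesis by (simp add: A_def sum_negf)
  qed
  have "jac \<phi> \<psi> \<theta> p = T \<phi> \<psi> \<theta> + T \<psi> \<theta> \<phi> + T \<theta> \<phi> \<psi>"
    unfolding jac_def nested[OF sm(2,3)] nested[OF sm(3,1)] nested[OF sm(1,2)]
    using AB[OF sm(1), of \<psi> \<theta>] AB[OF sm(2), of \<theta> \<phi>] AB[OF sm(3), of \<phi> \<psi>] by simp
  also have "T \<psi> \<theta> \<phi> = (\<Sum>a\<in>UNIV. \<Sum>b\<in>UNIV. \<Sum>c\<in>UNIV. (pd a \<phi> p * pd b \<psi> p * pd c \<theta> p) * K b c a)"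
  proof -
    have "T \<psi> \<theta> \<phi> = (\<Sum>b\<in>UNIV. \<Sum>c\<in>UNIV. \<Sum>a\<in>UNIV. (pd a \<phi> p * pd b \<psi> p * pd c \<theta> p) * K b c a)"
      unfolding T_def by (simp add: ac_simps)
    also have "\<dots> = (\<Sum>a\<in>UNIV. \<Sum>b\<in>UNIV. \<Sum>c\<in>UNIV. (pd a \<phi> p * pd b \<psi> p * pd c \<theta> p) * K b c a)"
      by (rule sum_rotate[symmetric])
    finally show ?thesis .
  qed
  also have "T \<theta> \<phi> \<psi> = (\<Sum>a\<in>UNIV. \<Sum>b\<in>UNIV. \<Sum>c\<in>UNIV. (pd a \<phi> p * pd b \<psi> p * pd c \<theta> p) * K c a b)"
  proof -
    have "T \<theta> \<phi> \<psi> = (\<Sum>c\<in>UNIV. \<Sum>a\<in>UNIV. \<Sum>b\<in>UNIV. (pd a \<phi> p * pd b \<psi> p * pd c \<theta> p) * K c a b)"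
      unfolding T_def by (simp add: ac_simps)
    also have "\<dots> = (\<Sum>a\<in>UNIV. \<Sum>b\<in>UNIV. \<Sum>c\<in>UNIV. (pd a \<phi> p * pd b \<psi> p * pd c \<theta> p) * K c a b)"
      by (rule sum_rotate)
    finally show ?thesis .
  qed
  finally show ?thesis
    unfolding T_def jac_def K_def by (simp add: Omega_coord[abs_def] sum.distrib distrib_left)
qed

section \<open>Brackets of matrix-valued functions\<close>

definition mpdiff :: "(('a::real_normed_field, 'n::finite) pt \<Rightarrow> ('a, 'n) mat) \<Rightarrow> ('a, 'n) pt \<Rightarrow> bool" where
  "mpdiff X p \<longleftrightarrow> (\<forall>i j. pdiff (\<lambda>q. X q $ i $ j) p)"

text \<open>The second slot stays scalar, so the result is a matrix of the same size and the Leibniz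
  rule keeps the order of matrix factors.\<close>

definition mbr :: "(('a::real_normed_field, 'n::{finite,linorder}) pt \<Rightarrow> ('a, 'n) mat)
    \<Rightarrow> (('a, 'n) pt \<Rightarrow> 'a) \<Rightarrow> ('a, 'n) pt \<Rightarrow> ('a, 'n) mat" where
  "mbr X \<psi> p = (\<chi> i j. Omega (\<lambda>q. X q $ i $ j) \<psi> p)"

lemma Omega_entry: "Omega (\<lambda>q. X q $ i $ j) \<psi> p = mbr X \<psi> p $ i $ j"
  by (simp add: mbr_def)

lemma pdiff_F: "pdiff (\<lambda>q. fst q $ i $ j) p" and pdiff_B: "pdiff (\<lambda>q. snd q $ i $ j) p"
  using pdiff_coord[of "(True, i, j)"] pdiff_coord[of "(False, i, j)"] by (simp_all add: coord_eq)

lemmas pdiff_intros = pdiff_F pdiff_B pdiff_const pdiff_add pdiff_diff pdiff_minus pdiff_mult pdiff_sum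

lemma mpdiff_F: "mpdiff fst p" and mpdiff_B: "mpdiff snd p" and mpdiff_const: "mpdiff (\<lambda>_. X0) p"
  by (simp_all add: mpdiff_def pdiff_intros)

lemma
  assumes "mpdiff X p"
  shows mpdiff_minus: "mpdiff (\<lambda>q. - X q) p"
    and mpdiff_transpose: "mpdiff (\<lambda>q. transpose (X q)) p"
    and mbr_minus: "mbr (\<lambda>q. - X q) \<psi> p = - mbr X \<psi> p"
    and mbr_transpose: "mbr (\<lambda>q. transpose (X q)) \<psi> p = transpose (mbr X \<psi> p)"
  using assms by (auto simp: mpdiff_def mbr_def transpose_def vec_eq_iff pdiff_intros Omega_minus_left)

text \<open>\<open>ham\<close> is linear in its matrix argument with constant coefficients, so a
  derivation passes through it.\<close>

lemma
  fixes X :: "('a::real_normed_field, 'n::{finite,linorder}) pt \<Rightarrow> ('a, 'n) mat"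
  assumes "mpdiff X p"
  shows mpdiff_ham: "mpdiff (\<lambda>q. ham (X q) k l) p"
    and mbr_ham: "mbr (\<lambda>q. ham (X q) k l) \<psi> p = ham (mbr X \<psi> p) k l"
proof -
  have X: "pdiff (\<lambda>q. X q $ i $ j) p" for i j
    using assms by (simp add: mpdiff_def)
  have "pdiff (\<lambda>q. ham (X q) k l $ a $ j) p \<and>
      Omega (\<lambda>q. ham (X q) k l $ a $ j) \<psi> p = ham (mbr X \<psi> p) k l $ a $ j" for a j
    by (cases "j = k"; cases "j = l")
      (simp_all add: ham_def mbr_def X pdiff_intros Omega_diff_left Omega_mult_left Omega_minus_left Omega_const_left)
  then show "mpdiff (\<lambda>q. ham (X q) k l) p" "mbr (\<lambda>q. ham (X q) k l) \<psi> p = ham (mbr X \<psi> p) k l"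
    by (simp_all add: mpdiff_def mbr_def vec_eq_iff)
qed

lemma
  assumes "mpdiff X p" "mpdiff Y p"
  shows mpdiff_add: "mpdiff (\<lambda>q. X q + Y q) p"
    and mpdiff_diff: "mpdiff (\<lambda>q. X q - Y q) p"
    and mpdiff_mult: "mpdiff (\<lambda>q. X q ** Y q) p"
    and mbr_add: "mbr (\<lambda>q. X q + Y q) \<psi> p = mbr X \<psi> p + mbr Y \<psi> p"
    and mbr_diff: "mbr (\<lambda>q. X q - Y q) \<psi> p = mbr X \<psi> p - mbr Y \<psi> p"
    and mbr_mult: "mbr (\<lambda>q. X q ** Y q) \<psi> p = mbr X \<psi> p ** Y p + X p ** mbr Y \<psi> p"
proof -
  have X: "pdiff (\<lambda>q. X q $ i $ j) p" and Y: "pdiff (\<lambda>q. Y q $ i $ j) p" for i j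
    using assms by (simp_all add: mpdiff_def)
  note [simp] = X Y pdiff_intros
  show "mpdiff (\<lambda>q. X q + Y q) p" "mpdiff (\<lambda>q. X q - Y q) p" "mpdiff (\<lambda>q. X q ** Y q) p"
    "mbr (\<lambda>q. X q + Y q) \<psi> p = mbr X \<psi> p + mbr Y \<psi> p"
    "mbr (\<lambda>q. X q - Y q) \<psi> p = mbr X \<psi> p - mbr Y \<psi> p"
    "mbr (\<lambda>q. X q ** Y q) \<psi> p = mbr X \<psi> p ** Y p + X p ** mbr Y \<psi> p"
    by (simp_all add: mpdiff_def mbr_def vec_eq_iff matrix_matrix_mult_def
        Omega_add_left Omega_diff_left Omega_sum_left Omega_mult_left sum.distrib)
qed

lemma mbr_const: "mbr (\<lambda>_. X) \<psi> p = 0"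
  by (simp add: mbr_def vec_eq_iff Omega_const_left)

lemmas mpdiff_intros = mpdiff_F mpdiff_B mpdiff_const mpdiff_minus mpdiff_transpose mpdiff_ham
  mpdiff_add mpdiff_diff mpdiff_mult

lemmas mbr_simps = mbr_minus mbr_transpose mbr_ham mbr_add mbr_diff mbr_mult mbr_const

lemma mbr_B_F: "mbr snd (\<lambda>q. fst q $ k $ l) p = snd p ** ham (fst p) k l"
  by (simp add: mbr_def vec_eq_iff Omega_entries brBF_entry)

lemma mbr_F_F: "mbr fst (\<lambda>q. fst q $ k $ l) p =
    - (ham (fst p) k l ** fst p + fst p ** transpose (ham (fst p) k l))"
  by (simp add: mbr_def vec_eq_iff Omega_entries brFF_eq_ham)

lemma Omega_BB: "Omega (\<lambda>q. snd q $ i $ j) (\<lambda>q. snd q $ k $ l) =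
    (\<lambda>p. (sg i k + sg j l) * (snd p $ k $ j * snd p $ i $ l))"
  by (rule ext) (simp add: Omega_entries brBB_entry)

lemma Omega_FF: "Omega (\<lambda>q. fst q $ i $ j) (\<lambda>q. fst q $ k $ l) =
    (\<lambda>p. - (sg i k + sg j l) * (fst p $ k $ j * fst p $ i $ l)
     - (1 + sg j k) * (fst p $ i $ k * fst p $ j $ l) + (1 + sg l i) * (fst p $ k $ i * fst p $ l $ j))"
  by (rule ext) (simp add: Omega_entries brFF_entry)

lemma Omega_FF_ham: "Omega (\<lambda>q. fst q $ i $ j) (\<lambda>q. fst q $ k $ l) =
    (\<lambda>p. (- (ham (fst p) k l ** fst p + fst p ** transpose (ham (fst p) k l))) $ i $ j)"
  by (rule ext) (simp add: Omega_entries brFF_eq_ham)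

lemma Omega_BF: "Omega (\<lambda>q. snd q $ i $ j) (\<lambda>q. fst q $ k $ l) =
    (\<lambda>p. (snd p ** ham (fst p) k l) $ i $ j)"
  by (rule ext) (simp add: Omega_entries brBF_entry)

lemma Omega_FB: "Omega (\<lambda>q. fst q $ k $ l) (\<lambda>q. snd q $ i $ j) =
    (\<lambda>p. - (snd p ** ham (fst p) k l) $ i $ j)"
  by (rule ext, subst Omega_skew) (simp add: Omega_BF)


section \<open>The Jacobi identity for the coordinates\<close>

text \<open>\<open>sg_cycle\<close> rewritten for products of the weights of \<open>r12\<close>; the
  correction lives on triple coincidences of indices.\<close>

lemma sg_prod:
  "(1 + sg a b) * (1 + sg b c) =
    (1 + sg a c) * (sg a b + sg b c) + (of_bool (a = b \<and> b = c) :: 'a::comm_ring_1)"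
proof -
  have "(1 + sg a b) * (1 + sg b c) = (1 + sg a c) * (sg a b + sg b c) +
      (1 + (sg a b * sg b c + sg b c * sg c a + sg c a * sg a b) :: 'a)"
    by (simp add: sg_swap[of a c] algebra_simps)
  then show ?thesis unfolding sg_cycle by simp
qed

text \<open>Only two cubic monomials occur, and each coefficient is a difference of
  \<open>sg_cycle\<close> for row and for column indices. What is left are opposite multiples
  supported where all three row or all three column indices coincide, and there the monomials are
  equal.\<close>

lemma jac_BBB:
  "jac (\<lambda>q. snd q $ m $ n) (\<lambda>q. snd q $ i $ j) (\<lambda>q. snd q $ k $ l) (p::('a::real_normed_field, 'n::{finite,linorder}) pt) = 0"
proof -
  define B where "B = snd p"
  note swaps = sg_swap[of m k] sg_swap[of i m] sg_swap[of k i] sg_swap[of n l] sg_swap[of j n] sg_swap[of l j]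
  note cycles = sg_cycle[of i k m, where 'a = 'a] sg_cycle[of j l n, where 'a = 'a]
  have 1: "(sg i k + sg j l) * (sg m k + sg n j) + (sg k m + sg l n) * (sg i m + sg j l)
      + (sg m i + sg n j) * (sg k i + sg l n) = (of_bool (j = l \<and> l = n) - of_bool (i = k \<and> k = m) :: 'a)"
  proof -
    have "(sg i k + sg j l) * (sg m k + sg n j) + (sg k m + sg l n) * (sg i m + sg j l)
      + (sg m i + sg n j) * (sg k i + sg l n) =
      (sg j l * sg l n + sg l n * sg n j + sg n j * sg j l)
      - (sg i k * sg k m + sg k m * sg m i + sg m i * sg i k :: 'a)"
      unfolding swaps by (simp add: algebra_simps)
    then show ?thesis unfolding cycles by (simp add: of_bool_def)
  qed
  have 2: "(sg i k + sg j l) * (sg m i + sg n l) + (sg k m + sg l n) * (sg i k + sg j n)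
      + (sg m i + sg n j) * (sg k m + sg l j) = (of_bool (i = k \<and> k = m) - of_bool (j = l \<and> l = n) :: 'a)"
  proof -
    have "(sg i k + sg j l) * (sg m i + sg n l) + (sg k m + sg l n) * (sg i k + sg j n)
      + (sg m i + sg n j) * (sg k m + sg l j) =
      (sg i k * sg k m + sg k m * sg m i + sg m i * sg i k)
      - (sg j l * sg l n + sg l n * sg n j + sg n j * sg j l :: 'a)"
      unfolding swaps by (simp add: algebra_simps)
    then show ?thesis unfolding cycles by (simp add: of_bool_def)
  qed
  have "jac (\<lambda>q. snd q $ m $ n) (\<lambda>q. snd q $ i $ j) (\<lambda>q. snd q $ k $ l) p =
      ((sg i k + sg j l) * (sg m k + sg n j) + (sg k m + sg l n) * (sg i m + sg j l)
        + (sg m i + sg n j) * (sg k i + sg l n)) * (B $ k $ n * B $ m $ j * B $ i $ l)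
    + ((sg i k + sg j l) * (sg m i + sg n l) + (sg k m + sg l n) * (sg i k + sg j n)
        + (sg m i + sg n j) * (sg k m + sg l j)) * (B $ k $ j * B $ i $ n * B $ m $ l)"
    unfolding jac_def Omega_BB B_def
    by (simp add: Omega_mult_right Omega_const_right pdiff_intros Omega_BB) (simp add: algebra_simps)
  also have "\<dots> = 0"
  proof -
    have "B $ k $ n * B $ m $ j * B $ i $ l = B $ k $ j * B $ i $ n * B $ m $ l"
      if "(j = l \<and> l = n) \<or> (i = k \<and> k = m)"
      using that by (elim disjE conjE) (simp_all only: ac_simps)
    then show ?thesis
      unfolding 1 2 by (cases "j = l \<and> l = n"; cases "i = k \<and> k = m") simp_all
  qed
  finally show ?thesis .
qed

lemma ham_entry:
  "ham F k l $ a $ j = of_bool (j = k) * ((1 + sg a k) * F $ a $ l) - of_bool (j = l) * ((1 + sg l a) * F $ k $ a)"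
  by (simp add: ham_def)

lemma ham_mult:
  fixes F :: "('a::comm_ring_1, 'n::{finite,linorder}) mat"
  shows "(ham F k l ** X) $ a $ j = (1 + sg a k) * F $ a $ l * X $ k $ j - (1 + sg l a) * F $ k $ a * X $ l $ j"
  by (simp add: matrix_matrix_mult_def ham_def left_diff_distrib sum_subtractf delta_simps cong: if_cong)

text \<open>The coefficient of \<open>B\<^sub>k\<^sub>a B\<^sub>i\<^sub>b\<close> in the Jacobi identity for \<open>B\<^sub>i\<^sub>j\<close>, \<open>B\<^sub>k\<^sub>l\<close> and \<open>F\<^sub>m\<^sub>n\<close>.\<close>

lemma jac_BBF_coefficient:
  fixes F :: "('a::comm_ring_1, 'n::{finite,linorder}) mat"
  shows "(sg j l + sg b j) * of_bool (a = j) * ham F m n $ b $ l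
    + (sg j l - sg a l) * of_bool (b = l) * ham F m n $ a $ j
    - (of_bool (l = m) * ((1 + sg a m) * ham F a n $ b $ j) - of_bool (l = n) * ((1 + sg n a) * ham F m a $ b $ j))
    + (of_bool (j = m) * ((1 + sg b m) * ham F b n $ a $ l) - of_bool (j = n) * ((1 + sg n b) * ham F m b $ a $ l))
    = 0" (is "?K = 0")
proof -
  define A L Lm Ln Jm Jn :: 'a where "A = of_bool (a = j)" and "L = of_bool (b = l)"
    and "Lm = of_bool (l = m)" and "Ln = of_bool (l = n)" and "Jm = of_bool (j = m)" and "Jn = of_bool (j = n)"
  have A: "of_bool (j = a) = A" and L: "of_bool (l = b) = L"
    by (auto simp: A_def L_def)
  have sw: "sg a n + sg b a = - (sg n a + sg a b :: 'a)" "sg m b - sg a b = - (sg a b + sg b m :: 'a)"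
    "sg n b - sg a b = (sg n b + sg b a :: 'a)"
    by (simp_all add: sg_swap[of n a] sg_swap[of a b] sg_swap[of b m])
  \<comment> \<open>The Kronecker deltas allow index replacements that turn each sum of signs into a
    chain to which \<open>sg_prod\<close> applies.\<close>
  have c: "(sg j l + sg b j) * A * Lm = (sg b a + sg a m) * A * Lm"
    "(sg j l + sg b j) * A * Ln = - (sg n a + sg a b) * A * Ln"
    "(sg j l - sg a l) * L * Jm = - (sg a b + sg b m) * L * Jm"
    "(sg j l - sg a l) * L * Jn = (sg n b + sg b a) * L * Jn"
    unfolding sw[symmetric] by (auto simp: A_def L_def Lm_def Ln_def Jm_def Jn_def)
  have e: "(sg a b + sg b c) * (1 + sg a c) = (1 + sg a b) * (1 + sg b c) - (of_bool (a = b \<and> b = c) :: 'a)"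
    for a b c :: 'n
    unfolding sg_prod by (simp only: add_diff_cancel_right' mult.commute)
  have "?K = ((sg j l + sg b j) * A * Lm) * ((1 + sg b m) * F $ b $ n)
      - ((sg j l + sg b j) * A * Ln) * ((1 + sg n b) * F $ m $ b)
      + ((sg j l - sg a l) * L * Jm) * ((1 + sg a m) * F $ a $ n)
      - ((sg j l - sg a l) * L * Jn) * ((1 + sg n a) * F $ m $ a)
      - A * Lm * ((1 + sg b a) * (1 + sg a m)) * F $ b $ n
      - A * Ln * ((1 + sg n a) * (1 + sg a b)) * F $ m $ b
      + L * Jm * ((1 + sg a b) * (1 + sg b m)) * F $ a $ n
      + L * Jn * ((1 + sg n b) * (1 + sg b a)) * F $ m $ a"
    unfolding ham_entry A_def[symmetric] L_def[symmetric] Lm_def[symmetric] Ln_def[symmetric]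
      Jm_def[symmetric] Jn_def[symmetric] A L
    by (simp add: algebra_simps)
  also have "\<dots> = A * Lm * ((sg b a + sg a m) * (1 + sg b m) - (1 + sg b a) * (1 + sg a m)) * F $ b $ n
      + A * Ln * ((sg n a + sg a b) * (1 + sg n b) - (1 + sg n a) * (1 + sg a b)) * F $ m $ b
      - L * Jm * ((sg a b + sg b m) * (1 + sg a m) - (1 + sg a b) * (1 + sg b m)) * F $ a $ n
      - L * Jn * ((sg n b + sg b a) * (1 + sg n a) - (1 + sg n b) * (1 + sg b a)) * F $ m $ a"
    unfolding c by (simp add: algebra_simps)
  also have "\<dots> = 0"
  proof -
    \<comment> \<open>After \<open>sg_prod\<close> only triple coincidences survive, and they cancel
      in pairs.\<close>
    have "A * Lm * of_bool (b = a \<and> a = m) * F $ b $ n = L * Jm * of_bool (a = b \<and> b = m) * F $ a $ n"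
      "A * Ln * of_bool (n = a \<and> a = b) * F $ m $ b = L * Jn * of_bool (n = b \<and> b = a) * F $ m $ a"
      by (auto simp: A_def L_def Lm_def Ln_def Jm_def Jn_def)
    then show ?thesis unfolding e by simp
  qed
  finally show ?thesis .
qed

text \<open>All three terms are expanded in the products \<open>B $ k $ a * B $ i $ b\<close>, with
  \<open>D\<close> summing against the coefficients. The total coefficient is
  \<open>- K a b\<close>, which \<open>jac_BBF_coefficient\<close> shows to vanish.\<close>

lemma jac_BBF:
  "jac (\<lambda>q. snd q $ i $ j) (\<lambda>q. snd q $ k $ l) (\<lambda>q. fst q $ m $ n)
    (p::('a::real_normed_field, 'n::{finite,linorder}) pt) = 0"
proof -
  define F where "F = fst p"
  define B where "B = snd p"
  define K where "K a b = (sg j l + sg b j) * of_bool (a = j) * ham F m n $ b $ l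
    + (sg j l - sg a l) * of_bool (b = l) * ham F m n $ a $ j
    - (of_bool (l = m) * ((1 + sg a m) * ham F a n $ b $ j) - of_bool (l = n) * ((1 + sg n a) * ham F m a $ b $ j))
    + (of_bool (j = m) * ((1 + sg b m) * ham F b n $ a $ l) - of_bool (j = n) * ((1 + sg n b) * ham F m b $ a $ l))"
    for a b
  have BM: "Omega (\<lambda>q. snd q $ i $ j) (\<lambda>q. (snd q ** ham (fst q) m n) $ k $ l) p =
     (\<Sum>a\<in>UNIV. (sg i k + sg j a) * (B $ k $ j * B $ i $ a) * ham F m n $ a $ l)
     + (\<Sum>a\<in>UNIV. B $ k $ a * (of_bool (l = m) * ((1 + sg a m) * (B ** ham F a n) $ i $ j)
                    - of_bool (l = n) * ((1 + sg n a) * (B ** ham F m a) $ i $ j)))" for i j k l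
  proof -
    have "(\<lambda>q::('a, 'n) pt. (snd q ** ham (fst q) m n) $ k $ l) = (\<lambda>q. \<Sum>a\<in>UNIV. snd q $ k $ a *
        (of_bool (l = m) * ((1 + sg a m) * fst q $ a $ n) - of_bool (l = n) * ((1 + sg n a) * fst q $ m $ a)))"
      by (simp add: matrix_matrix_mult_def ham_entry)
    then show ?thesis
      by (simp add: Omega_sum_right Omega_mult_right Omega_diff_right Omega_const_right pdiff_intros
        Omega_BB Omega_BF B_def F_def ham_entry sum.distrib)
  qed
  have FBB: "Omega (\<lambda>q. fst q $ m $ n) (\<lambda>p. (sg i k + sg j l) * (snd p $ k $ j * snd p $ i $ l)) p =
      - (sg i k + sg j l) * ((B ** ham F m n) $ k $ j * B $ i $ l + B $ k $ j * (B ** ham F m n) $ i $ l)"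
    by (simp add: Omega_mult_right Omega_const_right pdiff_intros Omega_FB B_def F_def)
      (simp add: algebra_simps)
  have BFB: "Omega (\<lambda>q. snd q $ k $ l) (\<lambda>q. - (snd q ** ham (fst q) m n) $ i $ j) p =
      - Omega (\<lambda>q. snd q $ k $ l) (\<lambda>q. (snd q ** ham (fst q) m n) $ i $ j) p"
    using mpdiff_mult[OF mpdiff_B mpdiff_ham[OF mpdiff_F], of m n p] by (simp add: mpdiff_def Omega_minus_right)
  define D where "D f = (\<Sum>a\<in>UNIV. \<Sum>b\<in>UNIV. B $ k $ a * B $ i $ b * f a b)" for f
  have D_add: "D (\<lambda>a b. f a b + g a b) = D f + D g" and D_diff: "D (\<lambda>a b. f a b - g a b) = D f - D g"
    and D_scale: "D (\<lambda>a b. x * f a b) = x * D f" for f g x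
    by (simp_all add: D_def sum.distrib sum_subtractf sum_distrib_left algebra_simps)
  have 1: "(\<Sum>a\<in>UNIV. (sg i k + sg j a) * (B $ k $ j * B $ i $ a) * ham F m n $ a $ l) =
      D (\<lambda>a b. (sg i k + sg j b) * of_bool (a = j) * ham F m n $ b $ l)"
    by (simp add: D_def of_bool_def delta_simps ac_simps cong: if_cong)
  have 2: "(\<Sum>a\<in>UNIV. (sg k i + sg l a) * (B $ i $ l * B $ k $ a) * ham F m n $ a $ j) =
      D (\<lambda>a b. (sg k i + sg l a) * of_bool (b = l) * ham F m n $ a $ j)"
    by (simp add: D_def of_bool_def delta_simps ac_simps cong: if_cong)
  have 3: "(\<Sum>a\<in>UNIV. B $ k $ a * (of_bool (l = m) * ((1 + sg a m) * (B ** ham F a n) $ i $ j)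
        - of_bool (l = n) * ((1 + sg n a) * (B ** ham F m a) $ i $ j))) =
      D (\<lambda>a b. of_bool (l = m) * ((1 + sg a m) * ham F a n $ b $ j)
        - of_bool (l = n) * ((1 + sg n a) * ham F m a $ b $ j))"
    unfolding D_def matrix_matrix_mult_def
    by (simp add: sum_distrib_left sum_subtractf right_diff_distrib ac_simps)
  have "(\<Sum>b\<in>UNIV. B $ i $ b * (of_bool (j = m) * ((1 + sg b m) * (B ** ham F b n) $ k $ l)
        - of_bool (j = n) * ((1 + sg n b) * (B ** ham F m b) $ k $ l))) =
      (\<Sum>b\<in>UNIV. \<Sum>a\<in>UNIV. B $ k $ a * B $ i $ b * (of_bool (j = m) * ((1 + sg b m) * ham F b n $ a $ l)
        - of_bool (j = n) * ((1 + sg n b) * ham F m b $ a $ l)))"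
    unfolding matrix_matrix_mult_def
    by (simp add: sum_distrib_left sum_subtractf right_diff_distrib ac_simps)
  then have 4: "(\<Sum>b\<in>UNIV. B $ i $ b * (of_bool (j = m) * ((1 + sg b m) * (B ** ham F b n) $ k $ l)
        - of_bool (j = n) * ((1 + sg n b) * (B ** ham F m b) $ k $ l))) =
      D (\<lambda>a b. of_bool (j = m) * ((1 + sg b m) * ham F b n $ a $ l)
        - of_bool (j = n) * ((1 + sg n b) * ham F m b $ a $ l))"
    unfolding D_def by (rule trans[OF _ sum.swap])
  have 5: "(B ** ham F m n) $ k $ j * B $ i $ l = D (\<lambda>a b. of_bool (b = l) * ham F m n $ a $ j)"
    "B $ k $ j * (B ** ham F m n) $ i $ l = D (\<lambda>a b. of_bool (a = j) * ham F m n $ b $ l)"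
    unfolding D_def matrix_matrix_mult_def
    by (simp_all add: of_bool_def sum_distrib_left sum_distrib_right delta_simps ac_simps cong: if_cong)
  have "jac (\<lambda>q. snd q $ i $ j) (\<lambda>q. snd q $ k $ l) (\<lambda>q. fst q $ m $ n) p = D (\<lambda>a b. - K a b)"
  proof -
    \<comment> \<open>The signs \<open>sg i k\<close> of the row indices cancel here, which is why
      \<open>K\<close> does not mention \<open>i\<close> and \<open>k\<close>.\<close>
    have K: "- K a b = (sg i k + sg j b) * of_bool (a = j) * ham F m n $ b $ l
        + (of_bool (l = m) * ((1 + sg a m) * ham F a n $ b $ j) - of_bool (l = n) * ((1 + sg n a) * ham F m a $ b $ j))
        - ((sg k i + sg l a) * of_bool (b = l) * ham F m n $ a $ j
        + (of_bool (j = m) * ((1 + sg b m) * ham F b n $ a $ l) - of_bool (j = n) * ((1 + sg n b) * ham F m b $ a $ l)))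
        + (- (sg i k + sg j l)) * (of_bool (b = l) * ham F m n $ a $ j + of_bool (a = j) * ham F m n $ b $ l)" for a b
      unfolding K_def sg_swap[of i k] sg_swap[of b j] sg_swap[of a l] by (simp add: algebra_simps)
    show ?thesis
      unfolding jac_def Omega_BF Omega_FB Omega_BB BFB BM FBB 1 2 3 4 5 K D_add D_diff D_scale by simp
  qed
  moreover have "D (\<lambda>a b. - K a b) = 0"
    unfolding D_def K_def jac_BBF_coefficient by simp
  ultimately show ?thesis by simp
qed

section \<open>Flatness of the action of \<open>F\<close>, and the Jacobi identity with two or three
  entries of \<open>F\<close>\<close>

lemma
  fixes A B C :: "('a::ring_1, 'n::finite) mat"
  shows mat_diff_ldistrib: "A ** (B - C) = A ** B - A ** C"
    and mat_diff_rdistrib: "(A - B) ** C = A ** C - B ** C"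
    and mat_minus_left: "(- A) ** B = - (A ** B)"
    and mat_minus_right: "A ** (- B) = - (A ** B)"
    and transpose_add: "transpose (A + B) = transpose A + transpose B"
    and transpose_diff: "transpose (A - B) = transpose A - transpose B"
    and transpose_minus: "transpose (- A) = - transpose A"
  by (simp_all add: matrix_matrix_mult_def transpose_def vec_eq_iff right_diff_distrib left_diff_distrib
      sum_subtractf sum_negf)

lemma mat_add_rdistrib: "(A + B) ** C = A ** C + B ** (C :: ('a::ring_1, 'n::finite) mat)"
  by (simp add: matrix_matrix_mult_def vec_eq_iff distrib_right sum.distrib)

lemmas mat_simps = mat_diff_ldistrib mat_diff_rdistrib mat_minus_left mat_minus_right transpose_add
  transpose_diff transpose_minus matrix_add_ldistrib mat_add_rdistrib matrix_transpose_mul matrix_mul_assoc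

text \<open>The combination of the matrices \<open>ham\<close> that belongs to the function \<open>{F\<^sub>k\<^sub>l, F\<^sub>m\<^sub>n}\<close>.\<close>

definition ham_FF :: "('a::comm_ring_1, 'n::{finite,linorder}) mat \<Rightarrow> 'n \<Rightarrow> 'n \<Rightarrow> 'n \<Rightarrow> 'n \<Rightarrow> ('a, 'n) mat" where
  "ham_FF F k l m n = (\<chi> a j.
      - (sg k m + sg l n) * (ham F m l $ a $ j * F $ k $ n + F $ m $ l * ham F k n $ a $ j)
      - (1 + sg l m) * (ham F k m $ a $ j * F $ l $ n + F $ k $ m * ham F l n $ a $ j)
      + (1 + sg n k) * (ham F m k $ a $ j * F $ n $ l + F $ m $ k * ham F n l $ a $ j))"

text \<open>Only the columns \<open>k\<close> and \<open>l\<close> of \<open>ham F k l\<close> can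
  be nonzero. The two identities treat these columns in the flatness equation; the columns
  \<open>m\<close> and \<open>n\<close> follow by exchanging the two index pairs.\<close>

lemma ham_flat_coefficients:
  fixes F :: "('a::comm_ring_1, 'n::{finite,linorder}) mat"
  defines "D i j m n \<equiv> - (sg i m + sg j n) * (F $ m $ j * F $ i $ n)
     - (1 + sg j m) * (F $ i $ m * F $ j $ n) + (1 + sg n i) * (F $ m $ i * F $ n $ j)"
  shows "(1 + sg a m) * F $ a $ n * ((1 + sg m k) * F $ m $ l) - (1 + sg n a) * F $ m $ a * ((1 + sg n k) * F $ n $ l)
      + (1 + sg a k) * D a l m n =
      - (sg k m + sg l n) * (F $ m $ l * ((1 + sg a k) * F $ a $ n))
      - (1 + sg l m) * ((1 + sg a k) * F $ a $ m * F $ l $ n)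
      - (1 + sg n k) * ((1 + sg k a) * F $ m $ a * F $ n $ l)
      + (of_bool (a = m \<and> m = k) * (F $ a $ n * F $ m $ l) + of_bool (n = a \<and> a = k) * (F $ m $ a * F $ n $ l))"
    (is ?thesis1)
    and "- (1 + sg a m) * F $ a $ n * ((1 + sg l m) * F $ k $ m) + (1 + sg n a) * F $ m $ a * ((1 + sg l n) * F $ k $ n)
      - (1 + sg l a) * D k a m n =
      (sg k m + sg l n) * ((1 + sg l a) * F $ m $ a * F $ k $ n)
      - (1 + sg l m) * (F $ k $ m * ((1 + sg a l) * F $ a $ n))
      - (1 + sg n k) * (F $ m $ k * ((1 + sg l a) * F $ n $ a))
      + (of_bool (l = a \<and> a = m) * (F $ a $ n * F $ k $ m) + of_bool (l = n \<and> n = a) * (F $ m $ a * F $ k $ n))"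
    (is ?thesis2)
proof -
  have 1: "(1 + sg a m) * (1 + sg m k) - (1 + sg a k) * (sg a m + sg m k) = (of_bool (a = m \<and> m = k) :: 'a)"
    "(1 + sg n a) * (1 + sg a k) - (1 + sg n k) * (sg n a + sg a k) = (of_bool (n = a \<and> a = k) :: 'a)"
    "(1 + sg l a) * (1 + sg a m) - (1 + sg l m) * (sg l a + sg a m) = (of_bool (l = a \<and> a = m) :: 'a)"
    "(1 + sg l n) * (1 + sg n a) - (1 + sg l a) * (sg l n + sg n a) = (of_bool (l = n \<and> n = a) :: 'a)"
    by (simp_all add: sg_prod)
  show ?thesis1
    unfolding 1[symmetric] D_def sg_swap[of m k] sg_swap[of a k] by (simp add: algebra_simps)
  show ?thesis2
    unfolding 1[symmetric] D_def sg_swap[of n a] sg_swap[of l a] by (simp add: algebra_simps)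
qed

text \<open>Flatness of \<open>ham\<close>: since \<open>F\<^sub>k\<^sub>l\<close> acts through \<open>ham F k l\<close>, this is what the Jacobi identity
  requires for two entries of \<open>F\<close> and any third function.\<close>

lemma ham_flat:
  fixes F :: "('a::comm_ring_1, 'n::{finite,linorder}) mat"
  defines "D m n \<equiv> - (ham F m n ** F + F ** transpose (ham F m n))"
  shows "ham F m n ** ham F k l - ham F k l ** ham F m n + ham (D m n) k l - ham (D k l) m n = ham_FF F k l m n"
proof -
  have D: "D m n $ i $ j = - (sg i m + sg j n) * (F $ m $ j * F $ i $ n)
     - (1 + sg j m) * (F $ i $ m * F $ j $ n) + (1 + sg n i) * (F $ m $ i * F $ n $ j)" for m n i j
    unfolding D_def by (rule ham_action_entry)
  have "(ham F m n ** ham F k l - ham F k l ** ham F m n + ham (D m n) k l - ham (D k l) m n) $ a $ j =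
      ham_FF F k l m n $ a $ j" for a j
  proof -
    define dk dl dm dn :: 'a where "dk = of_bool (j = k)" and "dl = of_bool (j = l)"
      and "dm = of_bool (j = m)" and "dn = of_bool (j = n)"
    define f1 where "f1 k l m n = (1 + sg a m) * F $ a $ n * ((1 + sg m k) * F $ m $ l)
        - (1 + sg n a) * F $ m $ a * ((1 + sg n k) * F $ n $ l) + (1 + sg a k) * D m n $ a $ l" for k l m n
    define g1 where "g1 k l m n = - (sg k m + sg l n) * (F $ m $ l * ((1 + sg a k) * F $ a $ n))
      - (1 + sg l m) * ((1 + sg a k) * F $ a $ m * F $ l $ n)
      - (1 + sg n k) * ((1 + sg k a) * F $ m $ a * F $ n $ l)" for k l m n
    define f2 where "f2 k l m n = - (1 + sg a m) * F $ a $ n * ((1 + sg l m) * F $ k $ m)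
      + (1 + sg n a) * F $ m $ a * ((1 + sg l n) * F $ k $ n) - (1 + sg l a) * D m n $ k $ a" for k l m n
    define g2 where "g2 k l m n = (sg k m + sg l n) * ((1 + sg l a) * F $ m $ a * F $ k $ n)
      - (1 + sg l m) * (F $ k $ m * ((1 + sg a l) * F $ a $ n))
      - (1 + sg n k) * (F $ m $ k * ((1 + sg l a) * F $ n $ a))" for k l m n
    have fg: "f1 k l m n = g1 k l m n + (of_bool (a = m \<and> m = k) * (F $ a $ n * F $ m $ l)
        + of_bool (n = a \<and> a = k) * (F $ m $ a * F $ n $ l))"
      "f2 k l m n = g2 k l m n + (of_bool (l = a \<and> a = m) * (F $ a $ n * F $ k $ m)
        + of_bool (l = n \<and> n = a) * (F $ m $ a * F $ k $ n))" for k l m n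
      unfolding f1_def f2_def g1_def g2_def D by (rule ham_flat_coefficients)+
    have "(ham F m n ** ham F k l - ham F k l ** ham F m n + ham (D m n) k l - ham (D k l) m n) $ a $ j =
        dk * f1 k l m n + dl * f2 k l m n - dm * f1 m n k l - dn * f2 m n k l"
      by (simp add: ham_mult ham_entry f1_def f2_def dk_def[symmetric] dl_def[symmetric] dm_def[symmetric]
          dn_def[symmetric]) (simp add: algebra_simps)
    also have "\<dots> = dk * g1 k l m n + dl * g2 k l m n - dm * g1 m n k l - dn * g2 m n k l"
    proof -
      have c: "a = k \<and> k = m \<longleftrightarrow> a = m \<and> m = k" "n = l \<and> l = a \<longleftrightarrow> l = n \<and> n = a"
        by auto
      \<comment> \<open>The triple coincidences left over in the columns \<open>k\<close> and
        \<open>l\<close> cancel against those in the columns \<open>m\<close> and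
        \<open>n\<close>.\<close>
      have r1: "dk * (of_bool (a = m \<and> m = k) * (F $ a $ n * F $ m $ l)) =
            dm * (of_bool (a = k \<and> k = m) * (F $ a $ l * F $ k $ n))"
        by (cases "a = m \<and> m = k", elim conjE, hypsubst, unfold dk_def dm_def c, simp only: ac_simps, simp only: c of_bool_def if_False mult_zero_left mult_zero_right)
      have r2: "dk * (of_bool (n = a \<and> a = k) * (F $ m $ a * F $ n $ l)) =
            dn * (of_bool (n = a \<and> a = k) * (F $ a $ l * F $ m $ k))"
        by (cases "n = a \<and> a = k", elim conjE, hypsubst, unfold dk_def dn_def, simp only: ac_simps, simp only: c of_bool_def if_False mult_zero_left mult_zero_right)
      have r3: "dl * (of_bool (l = a \<and> a = m) * (F $ a $ n * F $ k $ m)) =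
            dm * (of_bool (l = a \<and> a = m) * (F $ k $ a * F $ l $ n))"
        by (cases "l = a \<and> a = m", elim conjE, hypsubst, unfold dl_def dm_def, simp only: ac_simps, simp only: c of_bool_def if_False mult_zero_left mult_zero_right)
      have r4: "dl * (of_bool (l = n \<and> n = a) * (F $ m $ a * F $ k $ n)) =
            dn * (of_bool (n = l \<and> l = a) * (F $ k $ a * F $ m $ l))"
        by (cases "l = n \<and> n = a", elim conjE, hypsubst, unfold dl_def dn_def c, simp only: ac_simps, simp only: c of_bool_def if_False mult_zero_left mult_zero_right)
      show ?thesis unfolding fg distrib_left r1 r2 r3 r4 by simp
    qed
    also have "\<dots> = ham_FF F k l m n $ a $ j"
      unfolding g1_def g2_def sg_swap[of k m] sg_swap[of l n]
      by (simp add: ham_FF_def ham_entry dk_def[symmetric] dl_def[symmetric] dm_def[symmetric]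
          dn_def[symmetric] sg_swap[of k m] sg_swap[of l n]) (simp add: algebra_simps)
    finally show ?thesis .
  qed
  then show ?thesis by (simp add: vec_eq_iff)
qed

text \<open>If all brackets of \<open>\<phi>\<close> with entries of \<open>F\<close> are one linear
  functional \<open>L\<close> of \<open>ham\<close>, the Leibniz rule turns the bracket with
  \<open>{F\<^sub>k\<^sub>l, F\<^sub>m\<^sub>n}\<close> into \<open>L\<close> of
  \<open>ham_FF\<close>. The two-term shape of \<open>L\<close> covers entries of \<open>B\<close>
  (second term zero) as well as entries of \<open>F\<close>.\<close>

lemma Omega_ham_FF:
  assumes "\<And>k l. Omega \<phi> (\<lambda>q. fst q $ k $ l) p = (X ** ham (fst p) k l ** Y) $ i $ j
      + (X' ** transpose (ham (fst p) k l) ** Y') $ i' $ j'"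
  shows "Omega \<phi> (Omega (\<lambda>q. fst q $ k $ l) (\<lambda>q. fst q $ m $ n)) p =
      (X ** ham_FF (fst p) k l m n ** Y) $ i $ j + (X' ** transpose (ham_FF (fst p) k l m n) ** Y') $ i' $ j'"
proof -
  define L where "L Z = (X ** Z ** Y) $ i $ j + (X' ** transpose Z ** Y') $ i' $ j'" for Z
  have L: "L Z = (\<Sum>b\<in>UNIV. \<Sum>a\<in>UNIV. X $ i $ a * Z $ a $ b * Y $ b $ j + X' $ i' $ a * Z $ b $ a * Y' $ b $ j')" for Z
    by (simp add: L_def matrix_matrix_mult_def transpose_def sum_distrib_right sum.distrib)
  have "L (ham_FF (fst p) k l m n) =
      - (sg k m + sg l n) * (L (ham (fst p) m l) * fst p $ k $ n + fst p $ m $ l * L (ham (fst p) k n))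
      - (1 + sg l m) * (L (ham (fst p) k m) * fst p $ l $ n + fst p $ k $ m * L (ham (fst p) l n))
      + (1 + sg n k) * (L (ham (fst p) m k) * fst p $ n $ l + fst p $ m $ k * L (ham (fst p) n l))"
    unfolding L ham_FF_def
    by (simp add: sum_distrib_left sum_distrib_right sum.distrib[symmetric] sum_subtractf[symmetric])
      (intro sum.cong refl; simp add: algebra_simps)
  moreover have "Omega \<phi> (\<lambda>q. fst q $ k $ l) p = L (ham (fst p) k l)" for k l
    unfolding L_def by (rule assms)
  ultimately show ?thesis
    unfolding Omega_FF L_def[symmetric]
    by (simp add: Omega_add_right Omega_diff_right Omega_mult_right Omega_const_right pdiff_intros)
qed

text \<open>The first term is \<open>B ** ham_FF\<close>; the other two add up to minus
  \<open>B\<close> times the left side of \<open>ham_flat\<close>.\<close>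

lemma jac_BFF:
  fixes p :: "('a::real_normed_field, 'n::{finite,linorder}) pt"
  shows "jac (\<lambda>q. snd q $ i $ j) (\<lambda>q. fst q $ k $ l) (\<lambda>q. fst q $ m $ n) p = 0"
proof -
  have 1: "Omega (\<lambda>q. snd q $ i $ j) (Omega (\<lambda>q. fst q $ k $ l) (\<lambda>q. fst q $ m $ n)) p =
      (snd p ** ham_FF (fst p) k l m n) $ i $ j"
    using Omega_ham_FF[of "\<lambda>q. snd q $ i $ j" p "snd p" "mat 1" i j 0 0 i j] by (simp add: Omega_BF)
  have 2: "Omega (\<lambda>q. fst q $ m $ n) (\<lambda>q. (snd q ** ham (fst q) k l) $ i $ j) p =
      - (snd p ** ham (fst p) m n ** ham (fst p) k l + snd p **
         ham (- (ham (fst p) m n ** fst p + fst p ** transpose (ham (fst p) m n))) k l) $ i $ j" for k l m n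
    by (subst Omega_skew) (simp add: Omega_entry mbr_mult mbr_ham mpdiff_intros mbr_B_F mbr_F_F)
  have 3: "Omega (\<lambda>q. fst q $ k $ l) (\<lambda>q. - (snd q ** ham (fst q) m n) $ i $ j) p =
      - Omega (\<lambda>q. fst q $ k $ l) (\<lambda>q. (snd q ** ham (fst q) m n) $ i $ j) p"
    using mpdiff_mult[OF mpdiff_B mpdiff_ham[OF mpdiff_F], of m n p] by (simp add: mpdiff_def Omega_minus_right)
  show ?thesis
    unfolding jac_def Omega_BF Omega_FB 1 3 2
    by (simp add: ham_flat[symmetric] mat_simps)
qed

text \<open>Flatness enters twice, multiplying \<open>F\<close> on the left and, transposed, on the
  right; the mixed products with one factor on each side cancel.\<close>

lemma jac_FFF:
  fixes p :: "('a::real_normed_field, 'n::{finite,linorder}) pt"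
  shows "jac (\<lambda>q. fst q $ i $ j) (\<lambda>q. fst q $ k $ l) (\<lambda>q. fst q $ m $ n) p = 0"
proof -
  have 1: "Omega (\<lambda>q. fst q $ i $ j) (Omega (\<lambda>q. fst q $ k $ l) (\<lambda>q. fst q $ m $ n)) p =
      (- (ham_FF (fst p) k l m n ** fst p + fst p ** transpose (ham_FF (fst p) k l m n))) $ i $ j"
    using Omega_ham_FF[of "\<lambda>q. fst q $ i $ j" p "- mat 1" "fst p" i j "- fst p" "mat 1" i j]
    by (simp add: Omega_FF_ham mat_simps)
  have 2: "Omega (\<lambda>q. fst q $ m $ n) (Omega (\<lambda>q. fst q $ i $ j) (\<lambda>q. fst q $ k $ l)) p =
      - mbr (\<lambda>q. - (ham (fst q) k l ** fst q + fst q ** transpose (ham (fst q) k l))) (\<lambda>q. fst q $ m $ n) p $ i $ j"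
    for k l m n
    unfolding Omega_FF_ham by (subst Omega_skew) (simp only: Omega_entry)
  have 3: "Omega (\<lambda>q. fst q $ k $ l) (Omega (\<lambda>q. fst q $ m $ n) (\<lambda>q. fst q $ i $ j)) p =
      - Omega (\<lambda>q. fst q $ k $ l) (Omega (\<lambda>q. fst q $ i $ j) (\<lambda>q. fst q $ m $ n)) p"
  proof -
    have "Omega (\<lambda>q. fst q $ m $ n) (\<lambda>q. fst q $ i $ j) =
        (\<lambda>q. - Omega (\<lambda>q. fst q $ i $ j) (\<lambda>q. fst q $ m $ n) (q :: ('a, 'n) pt))"
      by (rule ext) (rule Omega_skew)
    moreover have "pdiff (Omega (\<lambda>q. fst q $ i $ j) (\<lambda>q. fst q $ m $ n)) p"
      unfolding Omega_FF by (intro pdiff_intros)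
    ultimately show ?thesis by (simp only: Omega_minus_right)
  qed
  show ?thesis
    unfolding jac_def 3 1 2
    by (simp add: mbr_simps mpdiff_intros mbr_F_F ham_flat[symmetric] mat_simps)
qed

section \<open>The Poisson bracket\<close>

lemma jac_rotate: "jac \<phi> \<psi> \<theta> p = jac \<psi> \<theta> \<phi> p"
  by (simp add: jac_def)

text \<open>Up to cyclic rotation the eight patterns of flags reduce to the four cases
  above.\<close>

lemma jac_coord_zero: "jac (coord a) (coord b) (coord c) p = 0"
proof -
  obtain b1 i j b2 k l b3 m n where abc: "a = (b1, i, j)" "b = (b2, k, l)" "c = (b3, m, n)"
    by (cases a; cases b; cases c)
  have "jac (coord (b1, i, j)) (coord (b2, k, l)) (coord (b3, m, n)) p = 0"
    using jac_BBB[of i j k l m n p] jac_BBF[of i j k l m n p] jac_BFF[of i j k l m n p] jac_FFF[of i j k l m n p]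
      jac_BBF[of m n i j k l p, unfolded jac_rotate[of "\<lambda>q. snd q $ m $ n"]]
      jac_BBF[of k l m n i j p, folded jac_rotate[of "\<lambda>q. fst q $ i $ j"]]
      jac_BFF[of m n i j k l p, unfolded jac_rotate[of "\<lambda>q. snd q $ m $ n"]]
      jac_BFF[of k l m n i j p, folded jac_rotate[of "\<lambda>q. fst q $ i $ j"]]
    by (cases b1; cases b2; cases b3) (simp_all only: coord_eq)
  then show ?thesis unfolding abc .
qed

lemma open_GL: "open (GL :: ('a::real_normed_field, 'n::finite) mat set)"
proof -
  have "continuous_on UNIV (det :: ('a, 'n) mat \<Rightarrow> 'a)"
    unfolding det_def by (intro continuous_intros)
  then have "open {A :: ('a, 'n) mat. det A \<noteq> 0}"
    by (intro open_Collect_neq continuous_on_const)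
  then show ?thesis by (simp add: GL_def invertible_det_nz)
qed

lemma poisson_bracket_Omega:
  assumes U: "open U"
  shows "poisson_bracket_on U (Omega :: (('a::real_normed_field, 'n::{finite,linorder}) pt \<Rightarrow> 'a) \<Rightarrow> _)"
  unfolding poisson_bracket_on_def
proof (intro conjI allI impI ballI; (elim conjE)?)
  fix \<phi> \<phi>' \<psi> \<theta> :: "('a, 'n) pt \<Rightarrow> 'a" and p and c :: 'a
  assume p: "p \<in> U" and \<phi>: "smooth_on U \<phi>" and \<psi>: "smooth_on U \<psi>"
  note d = smooth_on_pdiff[OF \<phi> p] smooth_on_pdiff[OF \<psi> p]
  show "Omega \<phi> \<psi> p = Omega \<phi>' \<psi> p" if "\<forall>p\<in>U. \<phi> p = \<phi>' p"
    unfolding Omega_bivec using pd_cong(1)[OF U p, of \<phi> \<phi>'] that by simp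
  show "Omega \<phi> \<psi> p = - Omega \<psi> \<phi> p"
    by (rule Omega_skew)
  show "Omega (\<lambda>x. c * \<phi> x + \<psi> x) \<theta> p = c * Omega \<phi> \<theta> p + Omega \<psi> \<theta> p"
    by (simp add: Omega_add_left Omega_mult_left Omega_const_left pdiff_intros d)
  show "Omega (\<lambda>x. \<phi> x * \<psi> x) \<theta> p = \<phi> p * Omega \<psi> \<theta> p + Omega \<phi> \<theta> p * \<psi> p"
    by (simp add: Omega_mult_left d)
  show "Omega \<phi> (Omega \<psi> \<theta>) p + Omega \<psi> (Omega \<theta> \<phi>) p + Omega \<theta> (Omega \<phi> \<psi>) p = 0"
    if "smooth_on U \<theta>"
    using jac_coord[OF U p \<phi> \<psi> that] by (simp add: jac_coord_zero flip: jac_def)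
next
  fix \<phi> \<psi> :: "('a, 'n) pt \<Rightarrow> 'a"
  assume "smooth_on U \<phi>" "smooth_on U \<psi>"
  then show "smooth_on U (Omega \<phi> \<psi>)"
    by (rule smooth_on_Omega[OF U])
qed


section \<open>The groupoid\<close>

lemma invertible_transpose:
  fixes A :: "('a::comm_semiring_1, 'n::finite) mat"
  assumes "invertible A"
  shows "invertible (transpose A)"
  using assms unfolding invertible_def by (metis matrix_transpose_mul transpose_mat)

lemma groupoid_Gam:
  "groupoid GL (Gam :: ('a::comm_semiring_1, 'n::finite) pt set) src tgt gmult"
  unfolding groupoid_def
proof (intro conjI ballI impI)
  show "src ` Gam \<subseteq> GL" "tgt ` (Gam :: ('a, 'n) pt set) \<subseteq> GL"
    by (auto simp: Gam_def GL_def invertible_mult invertible_transpose)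
  show "gmult x y \<in> Gam" "src (gmult x y) = src x" "tgt (gmult x y) = tgt y"
    if "x \<in> Gam" "y \<in> Gam" "tgt x = src y" for x y :: "('a, 'n) pt"
    using that by (auto simp: Gam_def GL_def invertible_mult matrix_transpose_mul matrix_mul_assoc)
  show "gmult (gmult x y) z = gmult x (gmult y z)" for x y z :: "('a, 'n) pt"
    by (cases x; cases y; cases z) (simp add: matrix_mul_assoc)
  have "\<exists>y\<in>Gam. src y = tgt x \<and> tgt y = src x \<and> gmult x y = (src x, mat 1) \<and> gmult y x = (tgt x, mat 1)"
    if "x \<in> Gam" for x :: "('a, 'n) pt"
  proof -
    obtain F B where x: "x = (F, B)" "invertible F" "invertible B"
      using \<open>x \<in> Gam\<close> by (auto simp: Gam_def GL_def)
    then obtain B' where B': "B ** B' = mat 1" "B' ** B = mat 1"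
      by (auto simp: invertible_def)
    have "B' ** (B ** F ** transpose B) ** transpose B' = (B' ** B) ** F ** transpose (B' ** B)"
      by (simp add: matrix_transpose_mul matrix_mul_assoc)
    moreover have "invertible B'"
      using B' by (auto simp: invertible_def)
    \<comment> \<open>The inverse of \<open>(F, B)\<close> starts at the target of
      \<open>(F, B)\<close> and carries the inverse matrix of \<open>B\<close>.\<close>
    ultimately show ?thesis
      using x B' by (intro bexI[of _ "(tgt x, B')"])
        (auto simp: Gam_def GL_def invertible_mult invertible_transpose)
  qed
  then show "\<exists>e. (\<forall>a\<in>GL. e a \<in> Gam \<and> src (e a) = a \<and> tgt (e a) = a) \<and>
      (\<forall>x\<in>Gam. gmult (e (src x)) x = x \<and> gmult x (e (tgt x)) = x) \<and>
      (\<forall>x\<in>(Gam :: ('a, 'n) pt set). \<exists>y\<in>Gam. src y = tgt x \<and> tgt y = src x \<and>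
        gmult x y = e (src x) \<and> gmult y x = e (tgt x))"
    by (intro exI[of _ "\<lambda>F. (F, mat 1)"]) (auto simp: Gam_def GL_def invertible_def)
qed

lemma constr_eq:
  "constr_f (x, y, z) = snd z - snd y ** snd x"
  "constr_g (x, y, z) = fst z - fst x"
  "constr_h (x, y, z) = fst y - tgt x"
  by (cases x; cases y; cases z; simp)+

lemma tgt_eq: "tgt = (\<lambda>u. snd u ** fst u ** transpose (snd u))"
  by auto

text \<open>Vanishing of \<open>constr_f\<close> and \<open>constr_g\<close> says that the third
  point is the product, and vanishing of \<open>constr_h\<close> that the first two points are
  composable.\<close>

lemma graph_eq_surface: "graph_of_mult = (constraint_surface :: ('a::comm_ring_1, 'n::finite) pt3 set)"
proof (intro set_eqI iffI)
  fix w :: "('a, 'n) pt3"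
  obtain x y z where w: "w = (x, y, z)" by (cases w)
  have src: "src = (fst :: ('a, 'n) pt \<Rightarrow> _)" by auto
  have m: "gmult x y = (fst x, snd y ** snd x)" by (cases x; cases y) simp
  show "w \<in> constraint_surface" if "w \<in> graph_of_mult"
    using that unfolding w graph_of_mult_def constraint_surface_def
    by (auto simp: constr_eq src m Gam_def GL_def invertible_mult simp del: constr_f.simps constr_g.simps constr_h.simps)
  show "w \<in> graph_of_mult" if "w \<in> constraint_surface"
  proof -
    from that have "x \<in> Gam" "y \<in> Gam" "snd z = snd y ** snd x" "fst z = fst x" "fst y = tgt x"
      unfolding w constraint_surface_def
      by (simp_all add: constr_eq del: constr_f.simps constr_g.simps constr_h.simps)
    moreover from this have "z = gmult x y" "tgt x = src y"
      by (simp_all add: m src prod_eq_iff)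
    ultimately show ?thesis
      unfolding w graph_of_mult_def by blast
  qed
qed


section \<open>The brackets of the constraints\<close>

lemma mpdiff_tgt: "mpdiff tgt (p :: ('a::real_normed_field, 'n::{finite,linorder}) pt)"
  unfolding tgt_eq by (intro mpdiff_intros)

lemma mbr_tgt: "mbr tgt \<psi> p = mbr snd \<psi> p ** fst p ** transpose (snd p)
    + snd p ** mbr fst \<psi> p ** transpose (snd p) + snd p ** fst p ** transpose (mbr snd \<psi> p)"
  unfolding tgt_eq by (simp add: mbr_simps mpdiff_intros mat_simps)

text \<open>The infinitesimal action of \<open>F\<^sub>k\<^sub>l\<close> changes \<open>B\<close>
  and \<open>F\<close> in opposite ways, so \<open>B ** F ** transpose B\<close> is invariant:
  source and target commute.\<close>

lemma mbr_tgt_F: "mbr tgt (\<lambda>u. fst u $ k $ l) p = 0"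
  by (simp add: mbr_tgt mbr_B_F mbr_F_F mat_simps)

lemma mbr_skew: "mbr X (\<lambda>u. Y u $ k $ l) p $ i $ j = - mbr Y (\<lambda>u. X u $ i $ j) p $ k $ l"
  by (simp add: mbr_def) (rule Omega_skew)

lemma mbr_F_tgt: "mbr fst (\<lambda>u. tgt u $ k $ l) p = 0"
  by (simp add: vec_eq_iff mbr_skew[of fst tgt] mbr_tgt_F)

text \<open>Computed with the slots exchanged. In the Leibniz expansion the signs that involve the
  summed inner indices cancel, so the inner sums reassemble to entries of the target.\<close>

lemma mbr_B_tgt: "mbr snd (\<lambda>u. tgt u $ k $ l) p = ham (tgt p) k l ** snd p"
proof -
  define F where "F = fst p"
  define B where "B = snd p"
  have "mbr tgt (\<lambda>u. snd u $ i $ j) p $ k $ l = - (ham (tgt p) k l ** B) $ i $ j" for i j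
  proof -
    have U: "mbr snd (\<lambda>u. snd u $ i $ j) p $ a $ b = (sg a i + sg b j) * (B $ i $ b * B $ a $ j)" for a b
      by (simp add: mbr_def Omega_BB B_def)
    have V: "mbr fst (\<lambda>u. snd u $ i $ j) p $ a $ b =
        of_bool (j = b) * (\<Sum>c\<in>UNIV. B $ i $ c * ((1 + sg j c) * F $ a $ c))
        - of_bool (j = a) * (\<Sum>c\<in>UNIV. B $ i $ c * ((1 + sg c j) * F $ c $ b))" for a b
      by (simp add: mbr_def Omega_FB B_def F_def matrix_matrix_mult_def ham_entry right_diff_distrib
          sum_subtractf of_bool_def)
    have 1: "(mbr snd (\<lambda>u. snd u $ i $ j) p ** F ** transpose B) $ k $ l =
        (\<Sum>b\<in>UNIV. \<Sum>a\<in>UNIV. (sg k i + sg a j) * (B $ k $ j * (B $ i $ a * F $ a $ b * B $ l $ b)))"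
      by (simp add: matrix_matrix_mult_def transpose_def U sum_distrib_left sum_distrib_right ac_simps)
    have 2: "(B ** F ** transpose (mbr snd (\<lambda>u. snd u $ i $ j) p)) $ k $ l =
        (\<Sum>b\<in>UNIV. \<Sum>a\<in>UNIV. (sg l i + sg b j) * (B $ l $ j * (B $ k $ a * F $ a $ b * B $ i $ b)))"
      by (simp add: matrix_matrix_mult_def transpose_def U sum_distrib_left sum_distrib_right ac_simps)
    have 3: "(B ** mbr fst (\<lambda>u. snd u $ i $ j) p ** transpose B) $ k $ l =
        (\<Sum>b\<in>UNIV. \<Sum>a\<in>UNIV. (1 + sg j b) * (B $ l $ j * (B $ k $ a * F $ a $ b * B $ i $ b)))
        - (\<Sum>b\<in>UNIV. \<Sum>c\<in>UNIV. (1 + sg c j) * (B $ k $ j * (B $ i $ c * F $ c $ b * B $ l $ b)))"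
      by (simp add: matrix_matrix_mult_def transpose_def V sum_distrib_left sum_distrib_right
          right_diff_distrib left_diff_distrib sum_subtractf of_bool_def delta_simps ac_simps cong: if_cong)
        (rule sum.swap)
    have G: "tgt p $ k $ l = (\<Sum>b\<in>UNIV. \<Sum>a\<in>UNIV. B $ k $ a * F $ a $ b * B $ l $ b)" for k l
      by (simp add: tgt_eq matrix_matrix_mult_def transpose_def sum_distrib_right B_def F_def)
    have "mbr tgt (\<lambda>u. snd u $ i $ j) p $ k $ l =
        (\<Sum>b\<in>UNIV. \<Sum>a\<in>UNIV. (sg k i + sg a j) * (B $ k $ j * (B $ i $ a * F $ a $ b * B $ l $ b))
          - (1 + sg a j) * (B $ k $ j * (B $ i $ a * F $ a $ b * B $ l $ b)))
      + (\<Sum>b\<in>UNIV. \<Sum>a\<in>UNIV. (1 + sg j b) * (B $ l $ j * (B $ k $ a * F $ a $ b * B $ i $ b))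
          + (sg l i + sg b j) * (B $ l $ j * (B $ k $ a * F $ a $ b * B $ i $ b)))"
      unfolding mbr_tgt vector_add_component F_def[symmetric] B_def[symmetric] 1 2 3
      by (simp add: sum.distrib sum_subtractf)
    also have "\<dots> = (\<Sum>b\<in>UNIV. \<Sum>a\<in>UNIV. - ((1 + sg i k) * B $ k $ j) * (B $ i $ a * F $ a $ b * B $ l $ b))
      + (\<Sum>b\<in>UNIV. \<Sum>a\<in>UNIV. ((1 + sg l i) * B $ l $ j) * (B $ k $ a * F $ a $ b * B $ i $ b))"
      by (intro arg_cong2[of _ _ _ _ plus] sum.cong refl)
        (simp_all add: sg_swap[of i k] sg_swap[of j b for b] algebra_simps)
    also have "\<dots> = - (ham (tgt p) k l ** B) $ i $ j"
      unfolding ham_mult G by (simp add: sum_distrib_left sum_distrib_right sum_negf ac_simps)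
    finally show ?thesis .
  qed
  then show ?thesis
    by (simp add: vec_eq_iff mbr_skew[of snd tgt] B_def)
qed

section \<open>Brackets of pairs of constraints on the triple product\<close>

lemma Omega3_skew: "Omega3 \<phi> \<psi> w = - Omega3 \<psi> \<phi> w"
proof -
  obtain x y z where w: "w = (x, y, z)" by (cases w)
  show ?thesis
    using Omega_skew[of "\<lambda>u. \<phi> (u, y, z)" "\<lambda>u. \<psi> (u, y, z)" x]
      Omega_skew[of "\<lambda>u. \<phi> (x, u, z)" "\<lambda>u. \<psi> (x, u, z)" y]
      Omega_skew[of "\<lambda>u. \<phi> (x, y, u)" "\<lambda>u. \<psi> (x, y, u)" z]
    by (simp add: w)
qed

lemma Omega3_constraints:
  fixes w :: "('a::real_normed_field, 'n::{finite,linorder}) pt3"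
  assumes "w \<in> constraint_surface"
  shows "Omega3 (\<lambda>w. constr_f w $ i $ j) (\<lambda>w. constr_f w $ k $ l) w = 0"
    and "Omega3 (\<lambda>w. constr_g w $ i $ j) (\<lambda>w. constr_g w $ k $ l) w = 0"
    and "Omega3 (\<lambda>w. constr_h w $ i $ j) (\<lambda>w. constr_h w $ k $ l) w = 0"
    and "Omega3 (\<lambda>w. constr_f w $ i $ j) (\<lambda>w. constr_g w $ k $ l) w = 0"
    and "Omega3 (\<lambda>w. constr_f w $ i $ j) (\<lambda>w. constr_h w $ k $ l) w = 0"
    and "Omega3 (\<lambda>w. constr_g w $ i $ j) (\<lambda>w. constr_h w $ k $ l) w = 0"
proof -
  obtain x y z where w: "w = (x, y, z)" by (cases w)
  have B3: "snd z = snd y ** snd x" and F3: "fst z = fst x" and F2: "fst y = tgt x"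
    using assms by (simp_all add: w constraint_surface_def constr_eq
        del: constr_f.simps constr_g.simps constr_h.simps)
  have pdiff: "pdiff (\<lambda>u. (snd u) $ k $ l) u" "pdiff (\<lambda>u. (fst u) $ k $ l) u" "pdiff (\<lambda>u. tgt u $ k $ l) u"
    for k l and u :: "('a, 'n) pt"
    using mpdiff_tgt[of u] by (simp_all add: mpdiff_def pdiff_intros)
  note mbr = mbr_simps mbr_B_F mbr_F_F mbr_tgt_F mbr_F_tgt mbr_B_tgt
  \<comment> \<open>Here \<open>k\<close> and \<open>l\<close> are the fixed indices of the second
    function, so only the second slot is split and the first stays matrix-valued for
    \<open>Omega_entry\<close>.\<close>
  have split: "(A - fst u) $ k $ l = A $ k $ l - fst u $ k $ l" "(fst u - A) $ k $ l = fst u $ k $ l - A $ k $ l"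
    "(A - tgt u) $ k $ l = A $ k $ l - tgt u $ k $ l" for A and u :: "('a, 'n) pt"
    by simp_all
  note right = Omega_diff_right Omega_const_right pdiff pdiff_const
  note left = Omega_entry mpdiff_intros mpdiff_tgt mbr
  \<comment> \<open>The first and third factors contribute opposite terms because \<open>F3\<close>
    equals \<open>F1\<close>.\<close>
  show "Omega3 (\<lambda>w. constr_g w $ i $ j) (\<lambda>w. constr_g w $ k $ l) w = 0"
    unfolding w Omega3.simps constr_eq vector_minus_component
    by (simp add: Omega_diff_right Omega_diff_left Omega_const_right Omega_const_left pdiff pdiff_const
        Omega_FF F3)
  show "Omega3 (\<lambda>w. constr_f w $ i $ j) (\<lambda>w. constr_g w $ k $ l) w = 0"
    unfolding w Omega3.simps constr_eq split
    by (simp add: right del: vector_minus_component) (simp add: left B3 F3 matrix_mul_assoc mat_minus_right del: vector_minus_component)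
  \<comment> \<open>Only the first factor sees both functions, and there source and target
    commute.\<close>
  show "Omega3 (\<lambda>w. constr_g w $ i $ j) (\<lambda>w. constr_h w $ k $ l) w = 0"
    unfolding w Omega3.simps constr_eq split
    by (simp add: right del: vector_minus_component) (simp add: left del: vector_minus_component)
  \<comment> \<open>The first factor gives \<open>B2 ** ham (tgt x) k l ** B1\<close>, the second
    its negative, since \<open>F2\<close> is the target of \<open>x\<close>.\<close>
  show "Omega3 (\<lambda>w. constr_f w $ i $ j) (\<lambda>w. constr_h w $ k $ l) w = 0"
    unfolding w Omega3.simps constr_eq split
    by (simp add: right del: vector_minus_component) (simp add: left F2 matrix_mul_assoc mat_minus_right del: vector_minus_component)
  show "Omega3 (\<lambda>w. constr_h w $ i $ j) (\<lambda>w. constr_h w $ k $ l) w = 0"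
  proof -
    have "mbr tgt (\<lambda>u. tgt u $ k $ l) x = ham (tgt x) k l ** tgt x + tgt x ** transpose (ham (tgt x) k l)"
      by (simp add: mbr_tgt[of "\<lambda>u. tgt u $ k $ l"] mbr_B_tgt mbr_F_tgt)
        (simp add: tgt_eq matrix_mul_assoc matrix_transpose_mul)
    then show ?thesis
      unfolding w Omega3.simps constr_eq split
      by (simp add: right del: vector_minus_component) (simp add: left F2 del: vector_minus_component)
  qed
  \<comment> \<open>Multiplicativity of the bracket of \<open>B\<close>: the signs
    \<open>sg a b\<close> and \<open>sg b a\<close> of the inner indices cancel between the first
    two factors, which leaves the bracket of the product.\<close>
  show "Omega3 (\<lambda>w. constr_f w $ i $ j) (\<lambda>w. constr_f w $ k $ l) w = 0"
  proof -
    define X where "X = snd x"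
    define Y where "Y = snd y"
    note calc = Omega_diff_left Omega_diff_right Omega_const_left Omega_const_right Omega_sum_left Omega_sum_right
      Omega_mult_left Omega_mult_right pdiff_intros Omega_BB
    have x: "Omega (\<lambda>u. (snd z - Y ** snd u) $ i $ j) (\<lambda>u. (snd z - Y ** snd u) $ k $ l) x =
        (\<Sum>a\<in>UNIV. \<Sum>b\<in>UNIV. (sg a b + sg j l) * (Y $ i $ a * X $ a $ l * (Y $ k $ b * X $ b $ j)))"
      by (simp add: matrix_matrix_mult_def calc sum_distrib_left sum_distrib_right X_def[symmetric] ac_simps)
    have "Omega (\<lambda>u. (snd z - snd u ** X) $ i $ j) (\<lambda>u. (snd z - snd u ** X) $ k $ l) y =
        (\<Sum>a\<in>UNIV. \<Sum>b\<in>UNIV. (sg i k + sg a b) * (Y $ i $ b * X $ b $ l * (Y $ k $ a * X $ a $ j)))"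
      by (simp add: matrix_matrix_mult_def calc sum_distrib_left sum_distrib_right Y_def[symmetric] ac_simps)
    also have "\<dots> = (\<Sum>a\<in>UNIV. \<Sum>b\<in>UNIV. (sg i k + sg b a) * (Y $ i $ a * X $ a $ l * (Y $ k $ b * X $ b $ j)))"
      by (rule sum.swap)
    finally have y: "Omega (\<lambda>u. (snd z - snd u ** X) $ i $ j) (\<lambda>u. (snd z - snd u ** X) $ k $ l) y = \<dots>" .
    have z: "Omega (\<lambda>u. (snd u - Y ** X) $ i $ j) (\<lambda>u. (snd u - Y ** X) $ k $ l) z =
        (\<Sum>a\<in>UNIV. \<Sum>b\<in>UNIV. (sg i k + sg j l) * (Y $ i $ a * X $ a $ l * (Y $ k $ b * X $ b $ j)))"
    proof -
      have "Omega (\<lambda>u. (snd u - Y ** X) $ i $ j) (\<lambda>u. (snd u - Y ** X) $ k $ l) z =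
          (sg i k + sg j l) * ((Y ** X) $ i $ l * (Y ** X) $ k $ j)"
        by (simp add: calc B3 X_def Y_def)
      also have "\<dots> = (\<Sum>a\<in>UNIV. \<Sum>b\<in>UNIV. (sg i k + sg j l) * (Y $ i $ a * X $ a $ l * (Y $ k $ b * X $ b $ j)))"
        unfolding matrix_matrix_mult_def by (simp only: vec_lambda_beta sum_product) (simp only: sum_distrib_left)
      finally show ?thesis .
    qed
    have comb: "(sg a b + sg j l) * c + (sg i k + sg b a) * c = (sg i k + sg j l) * (c :: 'a)" for a b c
      by (simp add: sg_swap[of a b] algebra_simps)
    show ?thesis
      unfolding w Omega3.simps constr_eq X_def[symmetric] Y_def[symmetric] x y z
      by (simp only: sum.distrib[symmetric] comb diff_self)
  qed
qed

text \<open>Six of the nine ordered pairs of constraint types are computed; the other three follow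
  by skewness with the index pairs exchanged.\<close>

lemma Omega3_constraints_zero:
  fixes w :: "('a::real_normed_field, 'n::{finite,linorder}) pt3"
  assumes "\<phi> \<in> constraints" "\<psi> \<in> constraints" "w \<in> constraint_surface"
  shows "Omega3 \<phi> \<psi> w = 0"
proof -
  obtain c i j c' k l where c: "c \<in> {constr_f, constr_g, constr_h}" "\<phi> = (\<lambda>w. c w $ i $ j)"
    and c': "c' \<in> {constr_f, constr_g, constr_h}" "\<psi> = (\<lambda>w. c' w $ k $ l)"
    using assms(1,2) unfolding constraints_def by blast
  note 1 = Omega3_constraints[OF assms(3), of i j k l] Omega3_constraints[OF assms(3), of k l i j]
  show ?thesis
    using c(1) c'(1) 1 Omega3_skew[of \<phi> \<psi> w] unfolding c(2) c'(2) by auto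
qed

theorem lemma10p3:
  shows "groupoid GL (Gam :: ('a::real_normed_field, 'n::{finite,linorder}) pt set) src tgt gmult
    \<and> poisson_bracket_on (Gam :: ('a, 'n) pt set) Omega
    \<and> (graph_of_mult :: ('a, 'n) pt3 set) = constraint_surface
    \<and> (\<forall>\<phi>\<in>constraints. \<forall>\<psi>\<in>constraints. \<forall>p\<in>(constraint_surface :: ('a, 'n) pt3 set).
          Omega3 \<phi> \<psi> p = 0)"
proof (intro conjI ballI)
  show "groupoid GL (Gam :: ('a, 'n) pt set) src tgt gmult"
    by (rule groupoid_Gam)
  have "open (Gam :: ('a, 'n) pt set)"
    unfolding Gam_def by (intro open_Times open_GL)
  then show "poisson_bracket_on (Gam :: ('a, 'n) pt set) Omega"
    by (rule poisson_bracket_Omega)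
  show "(graph_of_mult :: ('a, 'n) pt3 set) = constraint_surface"
    by (rule graph_eq_surface)
qed (rule Omega3_constraints_zero)

end
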